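(* Let $n\ge4$. If $\mathcal{C}$ is an $\mathfrak{so}(2n)$ semispinorial code of distance $2$ (a quantum code of distance $2$ in $\mathcal{H}^{(n)}_+$ or $\mathcal{H}^{(n)}_-$ for the $\mathfrak{so}(2n)$ semispinorial quantum metric), then $$\dim(\mathcal{C})\le\frac1n2^{n-2}\ \text{ if $n$ is even},\qquad \dim(\mathcal{C})\le\frac{n-2}{n^2-1}2^{n-2}\ \text{ if $n$ is odd}.$$
   Context: Semispinorial quantum metrics: $\mathcal{H}^{(n)}=(\mathbb{C}^2)^{\otimes n}$ with computational basis $|x\rangle$, $x\in\{0,1\}^n$; $\mathcal{H}^{(n)}_+$ (resp. $\mathcal{H}^{(n)}_-$) is the span of the $|x\rangle$ with an even (resp. odd) number of ones, and $P_\pm$ is the orthogonal projection onto it. With Pauli matrices $\sigma_x,\sigma_y,\sigma_z$, put $U_k=\sigma_z^{\otimes k-1}\otimes\sigma_x\otimes I_2^{\otimes n-k}$ and $U_{n+k}=\sigma_z^{\otimes k-1}\otimes\sigma_y\otimes I_2^{\otimes n-k}$ for $1\le k\le n$. Let $\mathcal{E}=\operatorname{span}(\{P_\pm\}\cup\{P_\pm U_kU_lP_\pm:1\le k<l\le2n\})$, viewed as operators on $\mathcal{H}=\mathcal{H}^{(n)}_\pm$ (where $P_\pm$ is the identity); the $\mathfrak{so}(2n)$ semispinorial quantum metric on $\mathcal{H}^{(n)}_\pm$ is $\mathcal{E}_t=\mathbb{C}I_{\mathcal{H}}$ for $0\le t<1$ and $\mathcal{E}_t=\mathcal{E}^{\lfloor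 t\rfloor}$ (span of products of $\lfloor t\rfloor$ elements) for $t\ge1$. A quantum code is a subspace $\mathcal{C}\subseteq\mathcal{H}$ with orthogonal projection $P$; it detects an operator $E$ if $PEP$ is a scalar multiple of $P$; its distance is the largest $d$ such that it detects all $E\in\mathcal{E}_{d-1}$. *)

theory Defs
  imports "HOL-Analysis.Analysis"
begin

section \<open>Operators on complex coordinate spaces\<close>

text \<open>The library interpretation \<open>vec\<close> provides the complex notions of subspace, span and
  dimension for \<open>complex^'a\<close>. The scalar multiplication it uses does not scale matrices
  by complex numbers, hence the following interpretation.\<close>

global_interpretation cmat:
  vector_space "\<lambda>c::complex. map_matrix ((*) c) :: complex^'a^'b \<Rightarrow> complex^'a^'b"
  by unfold_locales (simp_all add: vec_eq_iff algebra_simps)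

definition adjoint_mat :: "complex^'a^'b \<Rightarrow> complex^'b^'a"
  where "adjoint_mat A = (\<chi> i j. cnj (A $ j $ i))"

definition is_orth_proj :: "complex^'a^'a \<Rightarrow> (complex^'a) set \<Rightarrow> bool"
  where "is_orth_proj P C \<longleftrightarrow> P ** P = P \<and> adjoint_mat P = P \<and> range ((*v) P) = C"

definition orth_proj :: "(complex^'a) set \<Rightarrow> complex^'a^'a"
  where "orth_proj C = (THE P. is_orth_proj P C)"

lemma adjoint_mat_mult: "adjoint_mat (A ** B) = adjoint_mat B ** adjoint_mat A"
  by (simp add: adjoint_mat_def matrix_matrix_mult_def vec_eq_iff mult.commute)

lemma is_orth_proj_unique:
  assumes "is_orth_proj P C" "is_orth_proj Q C"
  shows "P = Q"
proof -
  have absorb: "R ** S = S" if "is_orth_proj R C" "is_orth_proj S C" for R S :: "complex^'a^'a"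
  proof -
    have "R *v (S *v x) = S *v x" for x
    proof -
      have "S *v x \<in> range ((*v) R)"
        using that by (auto simp: is_orth_proj_def)
      then obtain y where "S *v x = R *v y" by auto
      then show ?thesis
        using that by (simp add: is_orth_proj_def matrix_vector_mul_assoc)
    qed
    then show ?thesis by (simp add: matrix_eq matrix_vector_mul_assoc)
  qed
  have "P = adjoint_mat (Q ** P)"
    using absorb[OF assms(2,1)] assms(1) by (simp add: is_orth_proj_def)
  also have "\<dots> = P ** Q"
    using assms by (simp add: adjoint_mat_mult is_orth_proj_def)
  also have "\<dots> = Q" using absorb[OF assms] .
  finally show ?thesis .
qed

lemma is_orth_proj_exists:
  fixes C :: "(complex^'a) set"
  assumes C: "vec.subspace C"
  shows "\<exists>P. is_orth_proj P C"
proof -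
  define h :: "complex^'a \<Rightarrow> complex^'a \<Rightarrow> complex"
    where "h u v = (\<Sum>i\<in>UNIV. u $ i * cnj (v $ i))" for u v
  have h_add: "h (u + v) w = h u w + h v w" for u v w
    by (simp add: h_def algebra_simps sum.distrib)
  have h_diff: "h (u - v) w = h u w - h v w" for u v w
    by (simp add: h_def algebra_simps sum_subtractf)
  have h_scale: "h (c *s u) w = c * h u w" for c u w
    by (simp add: h_def sum_distrib_left algebra_simps)
  have h_cnj: "h u v = cnj (h v u)" for u v
    by (simp add: h_def mult.commute)
  have h_Re: "Re (h u v) = u \<bullet> v" for u v
    by (simp add: h_def inner_vec_def inner_complex_def)
  have h_self: "u = 0" if "h u u = 0" for u
    using h_Re[of u u] that by simp
  have sub: "subspace C"
    unfolding subspace_def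
  proof (intro conjI ballI allI)
    show "0 \<in> C" using C by (rule vec.subspace_0)
    show "x + y \<in> C" if "x \<in> C" "y \<in> C" for x y
      using vec.subspace_add[OF C that] .
    show "c *\<^sub>R x \<in> C" if "x \<in> C" for c x
    proof -
      have "c *\<^sub>R x = complex_of_real c *s x"
        by (subst vec_eq_iff) (simp, simp add: scaleR_conv_of_real)
      then show ?thesis using vec.subspace_scale[OF C that] by simp
    qed
  qed
  have ex: "\<exists>y. y \<in> C \<and> (\<forall>c\<in>C. h (v - y) c = 0)" for v
  proof -
    obtain y z where y: "y \<in> span C" and z: "\<And>w. w \<in> span C \<Longrightarrow> orthogonal z w"
      and v: "v = y + z"
      using orthogonal_subspace_decomp_exists[of C v] by blast
    have "h z c = 0" if "c \<in> C" for c
    proof -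
      have "Re (h z c) = 0"
        using z[of c] that by (simp add: h_Re orthogonal_def span_base)
      moreover have "\<i> *s c \<in> C" using vec.subspace_scale[OF C that] .
      then have "Re (h z (\<i> *s c)) = 0"
        using z[of "\<i> *s c"] by (simp add: h_Re orthogonal_def span_base)
      then have "Im (h z c) = 0"
        by (simp add: h_cnj[of z] h_scale)
      ultimately show ?thesis by (simp add: complex_eq_iff)
    qed
    moreover have "y \<in> C" using y sub by (metis span_eq_iff)
    ultimately show ?thesis using v by (intro exI[of _ y]) simp
  qed
  then obtain f where fC: "f v \<in> C" and fo: "c \<in> C \<Longrightarrow> h (v - f v) c = 0" for v c
    by metis
  have uniq: "f v = y" if "y \<in> C" "\<And>c. c \<in> C \<Longrightarrow> h (v - y) c = 0" for v y
  proof -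
    have d: "f v - y \<in> C" using vec.subspace_diff[OF C fC that(1)] .
    have "h (f v - y) (f v - y) = h (v - y) (f v - y) - h (v - f v) (f v - y)"
      by (simp add: h_diff)
    also have "\<dots> = 0" using that(2)[OF d] fo[OF d] by simp
    finally show ?thesis using h_self by force
  qed
  have f_id: "f v = v" if "v \<in> C" for v
    by (rule uniq) (use that in \<open>simp_all add: h_def\<close>)
  have lin: "Vector_Spaces.linear (*s) (*s) f"
  proof unfold_locales
    show "f (u + v) = f u + f v" for u v
    proof (rule uniq)
      show "f u + f v \<in> C" using vec.subspace_add[OF C fC fC] .
      show "h (u + v - (f u + f v)) c = 0" if "c \<in> C" for c
        using fo[OF that, of u] fo[OF that, of v] by (simp add: h_diff h_add)
    qed
    show "f (k *s v) = k *s f v" for k v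
    proof (rule uniq)
      show "k *s f v \<in> C" using vec.subspace_scale[OF C fC] .
      show "h (k *s v - k *s f v) c = 0" if "c \<in> C" for c
        using fo[OF that, of v] by (simp add: h_diff h_scale)
    qed
  qed
  define P where "P = matrix f"
  have P: "P *v v = f v" for v
    unfolding P_def using matrix_works[OF lin] .
  have "P ** P = P"
    by (simp add: matrix_eq P f_id fC flip: matrix_vector_mul_assoc)
  moreover have "adjoint_mat P = P"
  proof -
    have sym: "h (f u) v = h u (f v)" for u v
    proof -
      have "h u (f v) = h (f u) (f v)"
        using fo[OF fC, of u v] by (simp add: h_diff)
      moreover have "cnj (h v (f u)) = cnj (h (f v) (f u))"
        using fo[OF fC, of v u] by (simp add: h_diff)
      ultimately show ?thesis by (metis h_cnj)
    qed
    have h_axis: "h u (axis i 1) = u $ i" for u i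
      by (simp add: h_def axis_def if_distrib cong: if_cong)
    have "P $ i $ j = f (axis j 1) $ i" for i j
      by (simp add: P_def matrix_def)
    then have "cnj (P $ j $ i) = P $ i $ j" for i j
      using sym[of "axis i 1" "axis j 1"] h_axis
      by (metis h_cnj complex_cnj_cnj)
    then show ?thesis by (simp add: adjoint_mat_def vec_eq_iff)
  qed
  moreover have "range ((*v) P) = C"
  proof
    show "range ((*v) P) \<subseteq> C" using fC by (auto simp: P)
    show "C \<subseteq> range ((*v) P)"
    proof
      fix v assume "v \<in> C"
      then have "v = P *v v" by (simp add: P f_id)
      then show "v \<in> range ((*v) P)" by (rule range_eqI)
    qed
  qed
  ultimately show ?thesis by (auto simp: is_orth_proj_def)
qed

lemma is_orth_proj_orth_proj:
  assumes "vec.subspace C"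
  shows "is_orth_proj (orth_proj C) C"
  unfolding orth_proj_def
  using is_orth_proj_exists[OF assms] is_orth_proj_unique by (metis theI)


section \<open>Quantum metrics and codes\<close>

text \<open>Operators on a subspace \<open>H\<close> of \<open>complex^'a\<close> are represented by the matrices \<open>A\<close> on the
  ambient space with \<open>P ** A ** P = A\<close>, where \<open>P\<close> is the projection onto \<open>H\<close>; the identity of
  \<open>H\<close> is then \<open>P\<close> itself.\<close>

definition op_products :: "complex^'a^'a \<Rightarrow> (complex^'a^'a) set \<Rightarrow> nat \<Rightarrow> (complex^'a^'a) set"
  where "op_products P S m = {foldr (**) As P | As. length As = m \<and> set As \<subseteq> S}"

definition op_power :: "complex^'a^'a \<Rightarrow> (complex^'a^'a) set \<Rightarrow> nat \<Rightarrow> (complex^'a^'a) set"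
  where "op_power P S m = cmat.span (op_products P S m)"

definition generated_metric ::
    "complex^'a^'a \<Rightarrow> (complex^'a^'a) set \<Rightarrow> real \<Rightarrow> (complex^'a^'a) set"
  where "generated_metric P S t =
    (if t < 1 then cmat.span {P} else op_power P S (nat \<lfloor>t\<rfloor>))"

definition detects :: "(complex^'a) set \<Rightarrow> complex^'a^'a \<Rightarrow> bool"
  where "detects C E \<longleftrightarrow>
    (\<exists>c. orth_proj C ** E ** orth_proj C = map_matrix ((*) c) (orth_proj C))"

text \<open>A code that detects every operator of every \<open>M t\<close>, such as one of dimension at most 1,
  has no finite largest \<open>d\<close> and hence no distance in the following sense.\<close>

definition is_code_distance ::
    "(real \<Rightarrow> (complex^'a^'a) set) \<Rightarrow> (complex^'a) set \<Rightarrow> nat \<Rightarrow> bool"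
  where "is_code_distance M C d \<longleftrightarrow>
    (let D = {d. 1 \<le> d \<and> (\<forall>E \<in> M (real d - 1). detects C E)}
     in d \<in> D \<and> (\<forall>d'\<in>D. d' \<le> d))"


section \<open>Semispinorial quantum metrics\<close>

text \<open>The \<open>n\<close> qubits are the elements of a finite linearly ordered type \<open>'n\<close>, so
  \<open>n = CARD('n)\<close>, and the computational basis is indexed by bit strings \<open>x :: 'n \<Rightarrow> bool\<close>
  with \<open>True\<close> for the bit 1. The matrix rows and columns of a single-qubit operator are
  likewise indexed by \<open>bool\<close>.\<close>

definition pauli_x :: "complex^bool^bool"
  where "pauli_x = (\<chi> a b. if a = b then 0 else 1)"

definition pauli_y :: "complex^bool^bool"
  where "pauli_y = (\<chi> a b. if a = b then 0 else if a then \<i> else - \<i>)"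

definition pauli_z :: "complex^bool^bool"
  where "pauli_z = (\<chi> a b. if a \<noteq> b then 0 else if a then -1 else 1)"

definition tensor :: "('n \<Rightarrow> complex^bool^bool) \<Rightarrow> complex^('n::finite \<Rightarrow> bool)^('n \<Rightarrow> bool)"
  where "tensor A = (\<chi> x y. \<Prod>q\<in>UNIV. A q $ x q $ y q)"

definition qubit_pos :: "'n::{finite,linorder} \<Rightarrow> nat"
  where "qubit_pos q = card {..q}"

lemma bij_betw_qubit_pos: "bij_betw (qubit_pos :: 'n::{finite,linorder} \<Rightarrow> nat) UNIV {1..CARD('n)}"
proof -
  have "strict_mono (qubit_pos :: 'n \<Rightarrow> nat)"
    by (auto simp: strict_mono_def qubit_pos_def intro!: psubset_card_mono)
  then have inj: "inj (qubit_pos :: 'n \<Rightarrow> nat)"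
    by (rule strict_mono_imp_inj_on)
  have "range (qubit_pos :: 'n \<Rightarrow> nat) \<subseteq> {1..CARD('n)}"
    by (auto simp: qubit_pos_def Suc_le_eq card_gt_0_iff card_mono[OF finite_class.finite_UNIV subset_UNIV])
  moreover have "card (range (qubit_pos :: 'n \<Rightarrow> nat)) = card {1..CARD('n)}"
    using inj by (simp add: card_image)
  ultimately have "range (qubit_pos :: 'n \<Rightarrow> nat) = {1..CARD('n)}"
    by (intro card_subset_eq) auto
  with inj show ?thesis by (simp add: bij_betw_def)
qed

text \<open>\<open>pauli_string k s\<close> is \<open>\<sigma>\<^sub>z \<otimes> \<dots> \<otimes> \<sigma>\<^sub>z \<otimes> s \<otimes> I \<otimes> \<dots> \<otimes> I\<close> with \<open>s\<close> at position \<open>k\<close>.\<close>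

definition pauli_string ::
    "nat \<Rightarrow> complex^bool^bool \<Rightarrow> complex^('n::{finite,linorder} \<Rightarrow> bool)^('n \<Rightarrow> bool)"
  where "pauli_string k s =
    tensor (\<lambda>q. if qubit_pos q < k then pauli_z else if qubit_pos q = k then s else mat 1)"

text \<open>\<open>clifford_gen k\<close> is meaningful for \<open>1 \<le> k \<le> 2 * CARD('n)\<close>.\<close>

definition clifford_gen :: "nat \<Rightarrow> complex^('n::{finite,linorder} \<Rightarrow> bool)^('n \<Rightarrow> bool)"
  where "clifford_gen k =
    (if k \<le> CARD('n) then pauli_string k pauli_x else pauli_string (k - CARD('n)) pauli_y)"

datatype chirality = Positive | Negative

definition has_chirality :: "chirality \<Rightarrow> ('n::finite \<Rightarrow> bool) \<Rightarrow> bool"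
  where "has_chirality s x \<longleftrightarrow> (s = Positive \<longleftrightarrow> even (card {q. x q}))"

definition semispin_space :: "chirality \<Rightarrow> (complex^('n::finite \<Rightarrow> bool)) set"
  where "semispin_space s = vec.span {axis x 1 | x. has_chirality s x}"

definition semispin_proj :: "chirality \<Rightarrow> complex^('n::finite \<Rightarrow> bool)^('n \<Rightarrow> bool)"
  where "semispin_proj s = orth_proj (semispin_space s)"

definition semispin_errors ::
    "chirality \<Rightarrow> (complex^('n::{finite,linorder} \<Rightarrow> bool)^('n \<Rightarrow> bool)) set"
  where "semispin_errors s = cmat.span ({semispin_proj s} \<union>
    {semispin_proj s ** clifford_gen k ** clifford_gen l ** semispin_proj s | k l. 1 \<le> k \<and> k < l \<and> l \<le> 2 * CARD('n)})"

definition semispinorial_metric ::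
    "chirality \<Rightarrow> real \<Rightarrow> (complex^('n::{finite,linorder} \<Rightarrow> bool)^('n \<Rightarrow> bool)) set"
  where "semispinorial_metric s = generated_metric (semispin_proj s) (semispin_errors s)"

definition semispinorial_code ::
    "chirality \<Rightarrow> (complex^('n::{finite,linorder} \<Rightarrow> bool)) set \<Rightarrow> nat \<Rightarrow> bool"
  where "semispinorial_code s C d \<longleftrightarrow>
    vec.subspace C \<and> C \<subseteq> semispin_space s \<and> is_code_distance (semispinorial_metric s) C d"

end

theory Submission
  imports Defs
begin

text \<open>Let \<open>P\<close> be the projection onto the code, \<open>K\<close> its rank, \<open>N = 2\<^bsup>n-1\<^esup>\<close>, and on matrices let
  \<open>T\<^sub>i X = U\<^sub>i X U\<^sub>i\<close> and \<open>\<Psi> = T\<^sub>1 + \<dots> + T\<^bsub>2n\<^esub>\<close>; the \<open>T\<^sub>i\<close> are commuting self-adjoint involutions for the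
  Hilbert-Schmidt product. Detection says that \<open>P (\<i> U\<^sub>k U\<^sub>l) P = a\<^sub>k\<^sub>l P\<close> with \<open>a\<^sub>k\<^sub>l\<close> real, so with
  \<open>A = \<Sum>\<^bsub>k<l\<^esub> a\<^sub>k\<^sub>l\<^sup>2\<close> one gets \<open>\<parallel>\<Psi> P\<parallel>\<^sup>2 = 2K (n + A)\<close>. On the other hand \<open>P\<^sub>\<plusminus>\<close> and the \<open>\<i> P\<^sub>\<plusminus> U\<^sub>k U\<^sub>l\<close> are
  orthogonal eigenvectors of \<open>\<Psi>\<^sup>2\<close> for \<open>4n\<^sup>2\<close> and \<open>4(n-2)\<^sup>2\<close>, and the components of \<open>P\<close> along them are
  known. On the rest of the matrices commuting with the parity operator, \<open>\<Psi>\<^sup>2 \<ge> m\<close> with \<open>m = 0\<close>, or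
  \<open>m = 4\<close> when \<open>n\<close> is odd: a joint eigenvalue of \<open>\<Psi>\<close> is a sum of \<open>2n\<close> signs with product 1, hence
  nonzero and even for odd \<open>n\<close>. Comparing both sides bounds \<open>K\<close>; the terms with \<open>A\<close> help
  because \<open>n \<ge> 4\<close>.\<close>

section \<open>Real inner product spaces\<close>

text \<open>Commuting self-adjoint involutions split \<open>W\<close> orthogonally into joint
  eigenspaces, on each of which their sum acts as the sum of the signs. In place of a spectral
  theorem, a vector is split along one involution at a time.\<close>

lemma sum_involutions_lower_bound:
  fixes T :: "'i \<Rightarrow> 'v::real_inner \<Rightarrow> 'v"
  assumes fin: "finite K"
    and lin: "\<And>k. k \<in> K \<Longrightarrow> linear (T k)"
    and inv: "\<And>k v. k \<in> K \<Longrightarrow> T k (T k v) = v"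
    and comm: "\<And>k l v. k \<in> K \<Longrightarrow> l \<in> K \<Longrightarrow> T k (T l v) = T l (T k v)"
    and sa: "\<And>k u v. k \<in> K \<Longrightarrow> T k u \<bullet> v = u \<bullet> T k v"
    and W: "subspace W" "\<And>k v. k \<in> K \<Longrightarrow> v \<in> W \<Longrightarrow> T k v \<in> W"
    and eig: "\<And>e v. v \<in> W \<Longrightarrow> v \<noteq> 0 \<Longrightarrow> (\<And>k. k \<in> K \<Longrightarrow> e k = 1 \<or> e k = -1) \<Longrightarrow>
      (\<And>k. k \<in> K \<Longrightarrow> T k v = e k *\<^sub>R v) \<Longrightarrow> c \<le> (\<Sum>k\<in>K. e k)\<^sup>2"
    and w: "w \<in> W"
  shows "c * (w \<bullet> w) \<le> (\<Sum>k\<in>K. T k w) \<bullet> (\<Sum>k\<in>K. T k w)"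
proof -
  define S where "S v = (\<Sum>k\<in>K. T k v)" for v
  have S_add: "S (u + v) = S u + S v" for u v
    by (simp add: S_def linear_add[OF lin] sum.distrib)
  have S_T: "T j (S v) = S (T j v)" if "j \<in> K" for j v
    using that by (simp add: S_def linear_sum[OF lin] comm cong: sum.cong)
  \<comment> \<open>\<open>F\<close> holds the involutions not yet known to act on \<open>v\<close>
    by a sign; for \<open>F = {}\<close> the vector is zero or a joint eigenvector, so that
    \<open>eig\<close> applies.\<close>
  have "c * (v \<bullet> v) \<le> S v \<bullet> S v"
    if "finite F" "F \<subseteq> K" "v \<in> W" "\<And>k. k \<in> K - F \<Longrightarrow> e k = 1 \<or> e k = -1"
      "\<And>k. k \<in> K - F \<Longrightarrow> T k v = e k *\<^sub>R v" for F e v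
    using that
  proof (induction F arbitrary: v e rule: finite_induct)
    case empty
    show ?case
    proof (cases "v = 0")
      case True
      then show ?thesis by simp
    next
      case False
      have "S v = (\<Sum>k\<in>K. e k) *\<^sub>R v"
        using empty by (simp add: S_def scaleR_sum_left)
      moreover have "c \<le> (\<Sum>k\<in>K. e k)\<^sup>2"
        using empty False by (intro eig[of v]) auto
      ultimately show ?thesis
        by (simp add: power2_eq_square mult_right_mono flip: mult.assoc)
    qed
  next
    case (insert j F)
    have j: "j \<in> K" using insert.prems by blast
    txt \<open>Both sides split orthogonally along the eigenspaces of \<open>T j\<close>, as \<open>S\<close> commutes with \<open>T j\<close>.\<close>
    define p where "p = (1/2) *\<^sub>R (v + T j v)"
    define q where "q = (1/2) *\<^sub>R (v - T j v)"
    have v: "v = p + q"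
      unfolding p_def q_def by (simp add: algebra_simps flip: scaleR_add_left)
    have Tp: "T j p = p" and Tq: "T j q = - q"
      using j by (simp_all add: p_def q_def linear_scale[OF lin] linear_add[OF lin]
          linear_diff[OF lin] inv algebra_simps)
    have pW: "p \<in> W" and qW: "q \<in> W"
      using W insert.prems(2) j
      by (auto simp: p_def q_def intro!: subspace_scale subspace_add subspace_diff)
    have other: "T k p = e k *\<^sub>R p \<and> T k q = e k *\<^sub>R q" if "k \<in> K - insert j F" for k
    proof -
      have k: "k \<in> K" using that by blast
      have "T k (T j v) = e k *\<^sub>R T j v"
        using comm[OF k j] insert.prems(4)[OF that] by (simp add: linear_scale[OF lin[OF j]])
      then show ?thesis using insert.prems(4)[OF that]
        by (simp add: p_def q_def linear_scale[OF lin[OF k]] linear_add[OF lin[OF k]]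
            linear_diff[OF lin[OF k]] algebra_simps)
    qed
    have p: "c * (p \<bullet> p) \<le> S p \<bullet> S p"
      by (rule insert.IH[where e = "e(j := 1)"])
        (use insert.prems pW Tp other in \<open>auto\<close>)
    have q: "c * (q \<bullet> q) \<le> S q \<bullet> S q"
      by (rule insert.IH[where e = "e(j := -1)"])
        (use insert.prems qW Tq other in \<open>auto\<close>)
    have orth: "a \<bullet> b = 0" if "T j a = a" "T j b = - b" for a b
      using sa[OF j, of a b] that by simp
    have "T j (S p) = S p" "T j (S q) = - S q"
    proof -
      show "T j (S p) = S p" by (simp add: S_T j Tp)
      have "S (- q) = - S q"
        by (simp add: S_def linear_neg[OF lin] sum_negf)
      then show "T j (S q) = - S q" by (simp add: S_T j Tq)
    qed
    then have "S p \<bullet> S q = 0" "p \<bullet> q = 0"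
      using orth Tp Tq by auto
    then show ?case
      using p q by (simp add: v S_add inner_add_left inner_add_right inner_commute algebra_simps)
  qed
  \<comment> \<open>With \<open>F = K\<close> no sign is prescribed, so the choice of
    \<open>e\<close> is arbitrary.\<close>
  from this[of K w "\<lambda>_. 1"] fin w show ?thesis by (simp add: S_def)
qed

text \<open>Subtracting from \<open>x\<close> its components along the \<open>b i\<close> leaves a
  remainder orthogonal to all of them. Their span is invariant under \<open>S o S\<close>, so cross
  terms vanish and both sides are the quadratic forms of the remainder.\<close>

lemma Bessel_remainder_bound:
  fixes S :: "'v::real_inner \<Rightarrow> 'v"
  assumes lin: "linear S" and sa: "\<And>u v. S u \<bullet> v = u \<bullet> S v"
    and fin: "finite I" and N: "N > 0"
    and orth: "\<And>i j. i \<in> I \<Longrightarrow> j \<in> I \<Longrightarrow> b i \<bullet> b j = (if i = j then N else 0)"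
    and eig: "\<And>i. i \<in> I \<Longrightarrow> S (S (b i)) = l i *\<^sub>R b i"
    and W: "subspace W" "x \<in> W" "\<And>i. i \<in> I \<Longrightarrow> b i \<in> W"
    and bound: "\<And>w. w \<in> W \<Longrightarrow> m * (w \<bullet> w) \<le> S w \<bullet> S w"
  shows "m * (x \<bullet> x - (\<Sum>i\<in>I. (x \<bullet> b i)\<^sup>2) / N) \<le> S x \<bullet> S x - (\<Sum>i\<in>I. l i * (x \<bullet> b i)\<^sup>2) / N"
proof -
  define y where "y = (\<Sum>i\<in>I. (x \<bullet> b i / N) *\<^sub>R b i)"
  define r where "r = x - y"
  have yb: "y \<bullet> b j = x \<bullet> b j" if "j \<in> I" for j
  proof -
    have "y \<bullet> b j = (\<Sum>i\<in>I. if i = j then x \<bullet> b j else 0)"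
      unfolding y_def inner_sum_left
      using that N by (intro sum.cong) (auto simp: orth)
    then show ?thesis using that fin by simp
  qed
  then have rb: "r \<bullet> b j = 0" if "j \<in> I" for j
    using that by (simp add: r_def inner_diff_left)
  have SSy: "S (S y) = (\<Sum>i\<in>I. (x \<bullet> b i / N * l i) *\<^sub>R b i)"
    by (simp add: y_def linear_sum[OF lin] linear_scale[OF lin] eig cong: sum.cong)
  have "r \<in> W"
    using W by (auto simp: r_def y_def intro!: subspace_diff subspace_sum subspace_scale)
  then have "m * (r \<bullet> r) \<le> S r \<bullet> S r" by (rule bound)
  also have "r \<bullet> r = r \<bullet> x"
  proof -
    have "r \<bullet> y = 0" by (simp add: y_def inner_sum_right rb)
    then show ?thesis by (simp add: r_def inner_diff_right)
  qed
  also have "\<dots> = x \<bullet> x - (\<Sum>i\<in>I. (x \<bullet> b i)\<^sup>2) / N"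
    by (simp add: r_def y_def inner_diff_left inner_sum_left sum_divide_distrib power2_eq_square
        inner_commute[of "b _"])
  \<comment> \<open>All is expressed through \<open>S o S\<close>, because the \<open>b i\<close>
    are eigenvectors of this square and not of \<open>S\<close> itself.\<close>
  also have "S r \<bullet> S r = S x \<bullet> S x - (\<Sum>i\<in>I. l i * (x \<bullet> b i)\<^sup>2) / N"
  proof -
    have "r \<bullet> S (S y) = 0" by (simp add: SSy inner_sum_right rb)
    then have "S r \<bullet> S r = r \<bullet> S (S x)"
      by (simp add: sa) (simp add: r_def linear_diff[OF lin] inner_diff_right)
    also have "\<dots> = S x \<bullet> S x - S (S y) \<bullet> x"
      by (simp add: r_def inner_diff_left sa)
    also have "S (S y) \<bullet> x = (\<Sum>i\<in>I. l i * (x \<bullet> b i)\<^sup>2) / N"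
      by (simp add: SSy inner_sum_left sum_divide_distrib power2_eq_square
        inner_commute[of "b _"] mult_ac)
    finally show ?thesis .
  qed
  finally show ?thesis .
qed

text \<open>\<open>K\<close> is the rank of the code projection, \<open>N\<close> the dimension of
  the semispinor space and \<open>a\<close> the sum of the squared detection coefficients.
  Multiplied by \<open>N / K\<close> the hypothesis becomes affine in \<open>a\<close>, and its
  constant term is the difference of the two sides of the claim.\<close>

lemma rank_bound_arithmetic:
  fixes n K N a m :: real
  assumes "K > 0" "N > 0" "a \<ge> 0" and m: "m = 0 \<and> n \<ge> 4 \<or> m = 4 \<and> n \<ge> 5"
    and le: "m * (K - (K\<^sup>2 + a * K\<^sup>2) / N) \<le>
      2 * K * (n + a) - (4 * n\<^sup>2 * K\<^sup>2 + 4 * (n - 2)\<^sup>2 * (a * K\<^sup>2)) / N"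
  shows "K * (4 * n\<^sup>2 - m) \<le> (2 * n - m) * N"
proof (rule ccontr)
  assume "\<not> ?thesis"
  then have gt: "(2 * n - m) * N < K * (4 * n\<^sup>2 - m)" by simp
  have "(m * (K - (K\<^sup>2 + a * K\<^sup>2) / N)) * (N / K) \<le>
    (2 * K * (n + a) - (4 * n\<^sup>2 * K\<^sup>2 + 4 * (n - 2)\<^sup>2 * (a * K\<^sup>2)) / N) * (N / K)"
    using le assms by (intro mult_right_mono) auto
  moreover have "(m * (K - (K\<^sup>2 + a * K\<^sup>2) / N)) * (N / K) = m * (N - K - a * K)"
    using assms by (simp add: field_simps power2_eq_square)
  moreover have "(2 * K * (n + a) - (4 * n\<^sup>2 * K\<^sup>2 + 4 * (n - 2)\<^sup>2 * (a * K\<^sup>2)) / N) * (N / K) =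
      2 * N * (n + a) - 4 * n\<^sup>2 * K - 4 * (n - 2)\<^sup>2 * (a * K)"
    using assms by (simp add: field_simps power2_eq_square)
  ultimately have "m * (N - K - a * K) \<le> 2 * N * (n + a) - 4 * n\<^sup>2 * K - 4 * (n - 2)\<^sup>2 * (a * K)"
    by simp
  then have *: "K * (4 * n\<^sup>2 - m) - (2 * n - m) * N + a * (K * (4 * (n - 2)\<^sup>2 - m) - 2 * N) \<le> 0"
    by (simp add: algebra_simps)
  txt \<open>If the bound fails, the coefficient of \<open>a\<close> in the inequality above is nonnegative.\<close>
  have "2 * N \<le> K * (4 * (n - 2)\<^sup>2 - m)"
  proof -
    have pos: "4 * n\<^sup>2 - m > 0" and pos': "4 * (n - 2)\<^sup>2 - m > 0"
      using m power_mono[of 4 n 2] power_mono[of 2 "n - 2" 2] power_mono[of 3 "n - 2" 2] by auto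
    \<comment> \<open>Right side minus left side is \<open>8 * n * (n - 1) * (n - 4)\<close> for
      \<open>m = 0\<close> and \<open>8 * (n - 1)^2 * (n - 5)\<close> for \<open>m = 4\<close>; this
      is where the lower bounds on \<open>n\<close> enter.\<close>
    have "2 * (4 * n\<^sup>2 - m) \<le> (4 * (n - 2)\<^sup>2 - m) * (2 * n - m)"
    proof -
      have "0 \<le> 8 * n * ((n - 1) * (n - 4))" if "m = 0"
        using m that by auto
      moreover have "0 \<le> 8 * ((n - 1) * ((n - 1) * (n - 5)))" if "m = 4"
        using m that by auto
      ultimately show ?thesis
        using m by (auto simp: algebra_simps power2_eq_square)
    qed
    then have "2 * (4 * n\<^sup>2 - m) * N \<le> (4 * (n - 2)\<^sup>2 - m) * ((2 * n - m) * N)"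
      using assms(2) by (simp add: mult_right_mono flip: mult.assoc)
    also have "\<dots> \<le> (4 * (n - 2)\<^sup>2 - m) * (K * (4 * n\<^sup>2 - m))"
      using gt pos' by (intro mult_left_mono) auto
    finally have "(2 * N) * (4 * n\<^sup>2 - m) \<le> (K * (4 * (n - 2)\<^sup>2 - m)) * (4 * n\<^sup>2 - m)"
      by (simp add: algebra_simps)
    then show ?thesis using pos by simp
  qed
  then have "0 \<le> a * (K * (4 * (n - 2)\<^sup>2 - m) - 2 * N)" using assms by simp
  with * gt show False by linarith
qed

lemma sum_symmetric_pairs:
  fixes g :: "'i::linorder \<Rightarrow> 'i \<Rightarrow> real"
  assumes fin: "finite K" and sym: "\<And>i j. i \<in> K \<Longrightarrow> j \<in> K \<Longrightarrow> g i j = g j i"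
  shows "(\<Sum>i\<in>K. \<Sum>j\<in>K. g i j) =
    (\<Sum>i\<in>K. g i i) + 2 * (\<Sum>(i, j)\<in>{(i, j) \<in> K \<times> K. i < j}. g i j)"
proof -
  define L where "L = {(i, j) \<in> K \<times> K. i < j}"
  define G where "G = {(i, j) \<in> K \<times> K. j < i}"
  define D where "D = (\<lambda>i. (i, i)) ` K"
  have "K \<times> K = D \<union> (L \<union> G)" "L \<inter> G = {}" "D \<inter> (L \<union> G) = {}"
    by (auto simp: L_def G_def D_def)
  moreover have "finite L" "finite G" "finite D"
    using fin by (auto simp: L_def G_def D_def intro: finite_subset[of _ "K \<times> K"])
  ultimately have "(\<Sum>(i, j)\<in>K \<times> K. g i j) =
      (\<Sum>(i, j)\<in>D. g i j) + ((\<Sum>(i, j)\<in>L. g i j) + (\<Sum>(i, j)\<in>G. g i j))"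
    by (simp add: sum.union_disjoint)
  moreover have "(\<Sum>(i, j)\<in>D. g i j) = (\<Sum>i\<in>K. g i i)"
    by (simp add: D_def sum.reindex inj_on_def)
  moreover have "(\<Sum>(i, j)\<in>G. g i j) = (\<Sum>(i, j)\<in>L. g i j)"
    by (rule sum.reindex_bij_witness[of _ prod.swap prod.swap]) (auto simp: L_def G_def sym)
  ultimately show ?thesis by (simp add: sum.cartesian_product L_def)
qed

section \<open>Complex matrices\<close>

lemma trace_mat_mult: "trace (mat c ** A) = c * trace (A :: complex^'a^'a)"
  by (simp add: trace_def matrix_matrix_mult_def mat_def if_distrib if_distribR sum_distrib_left cong: if_cong)

lemma mat_commute: "A ** mat c = mat c ** (A :: complex^'a^'a)"
  by (simp add: matrix_matrix_mult_def mat_def vec_eq_iff if_distrib if_distribR mult.commute cong: if_cong)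

lemma map_matrix_times: "map_matrix ((*) c) A = mat c ** (A :: complex^'a^'a)"
  by (simp add: matrix_matrix_mult_def mat_def vec_eq_iff if_distrib if_distribR cong: if_cong)

lemma mat_mult_mat: "mat c ** mat d = (mat (c * d) :: complex^'a^'a)"
  by (simp flip: map_matrix_times) (simp add: mat_def vec_eq_iff)

lemma scaleR_matrix: "r *\<^sub>R A = mat (complex_of_real r) ** (A :: complex^'a^'a)"
proof -
  have "(r *\<^sub>R A) $ i $ j = (map_matrix ((*) (complex_of_real r)) A) $ i $ j" for i j
    by (simp only: vector_scaleR_component map_matrix_def vec_lambda_beta scaleR_conv_of_real[where 'a = complex])
  then show ?thesis by (metis map_matrix_times vec_eq_iff)
qed

lemma mat_uminus_mult: "mat (- c) ** A = - (mat c ** (A :: complex^'a^'a))"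
  by (simp add: vec_eq_iff flip: map_matrix_times)

lemma matrix_mult_uminus:
  fixes A B :: "complex^'a^'a"
  shows "(- A) ** B = - (A ** B)" "A ** (- B) = - (A ** B)"
  by (simp_all add: matrix_matrix_mult_def vec_eq_iff sum_negf)

lemma matrix_mult_scaleR:
  fixes A B :: "complex^'a^'a"
  shows "(r *\<^sub>R A) ** B = r *\<^sub>R (A ** B)" "A ** (r *\<^sub>R B) = r *\<^sub>R (A ** B)"
  by (simp_all add: matrix_matrix_mult_def vec_eq_iff scaleR_sum_right)

lemma matrix_add_rdistrib:
  fixes A B C :: "complex^'a^'a"
  shows "(A + B) ** C = A ** C + B ** C"
  by (simp add: matrix_matrix_mult_def vec_eq_iff sum.distrib algebra_simps)

lemma diagonal_mult_nth:
  fixes A D :: "complex^'a^'a"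
  assumes "\<And>i j. i \<noteq> j \<Longrightarrow> D $ i $ j = 0"
  shows "(D ** A) $ i $ j = D $ i $ i * A $ i $ j" "(A ** D) $ i $ j = A $ i $ j * D $ j $ j"
proof -
  have "(\<Sum>k\<in>UNIV. D $ i $ k * A $ k $ j) = (\<Sum>k\<in>UNIV. if k = i then D $ i $ i * A $ i $ j else 0)"
    by (rule sum.cong) (auto simp: assms)
  then show "(D ** A) $ i $ j = D $ i $ i * A $ i $ j" by (simp add: matrix_matrix_mult_def)
  have "(\<Sum>k\<in>UNIV. A $ i $ k * D $ k $ j) = (\<Sum>k\<in>UNIV. if k = j then A $ i $ j * D $ j $ j else 0)"
    by (rule sum.cong) (auto simp: assms)
  then show "(A ** D) $ i $ j = A $ i $ j * D $ j $ j" by (simp add: matrix_matrix_mult_def)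
qed

lemma adjoint_mat_mat: "adjoint_mat (mat c :: complex^'a^'a) = mat (cnj c)"
  by (auto simp: adjoint_mat_def mat_def vec_eq_iff)

lemma inner_matrix: "A \<bullet> B = Re (trace (A ** adjoint_mat (B :: complex^'a^'a)))"
  by (simp add: trace_def inner_vec_def matrix_matrix_mult_def adjoint_mat_def inner_complex_def)

text \<open>For a basis \<open>B\<close> of \<open>C\<close>, \<open>P\<close> is the sum of the
  rank-one maps \<open>x\<close> to \<open>f b x *s b\<close> with coordinate functionals
  \<open>f b\<close>. Each has trace \<open>f b b\<close>, which is 1 because \<open>P\<close> fixes
  \<open>b\<close>.\<close>

lemma trace_eq_dim:
  fixes P :: "complex^'a^'a"
  assumes P: "is_orth_proj P C" and C: "vec.subspace C"
  shows "trace P = of_nat (vec.dim C)"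
proof -
  obtain B where B: "B \<subseteq> C" "vec.independent B" "C \<subseteq> vec.span B" "card B = vec.dim C"
    using vec.basis_exists[of C] by blast
  have finB: "finite B" using B(2) vec.finiteI_independent by blast
  have range: "P *v x \<in> vec.span B" for x
    using P B(3) by (auto simp: is_orth_proj_def)
  have Pb: "P *v b = b" if "b \<in> B" for b
  proof -
    have "b \<in> range ((*v) P)" using that B(1) P by (auto simp: is_orth_proj_def)
    then obtain y where "b = P *v y" by blast
    then show ?thesis using P by (simp add: is_orth_proj_def matrix_vector_mul_assoc)
  qed
  define f where "f b x = vec.representation B (P *v x) b" for b x
  have P_f: "P *v x = (\<Sum>b\<in>B. f b x *s b)" for x
    using vec.sum_representation_eq[OF B(2) range finB order_refl] by (simp add: f_def)
  have f_sum: "f b (\<Sum>i\<in>A. c i *s v i) = (\<Sum>i\<in>A. c i * f b (v i))" if "finite A"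
    for b and A :: "'a set" and c v
    using that
  proof (induction A rule: finite_induct)
    case empty
    show ?case using B(2) by (simp add: f_def vec.representation_zero)
  next
    case (insert a A)
    have "P *v (c a *s v a) = c a *s (P *v v a)" by (simp add: vector_scalar_commute)
    then show ?case using insert B(2)
      by (simp add: f_def matrix_vector_right_distrib vec.representation_add range
          vec.representation_scale vec.span_scale)
  qed
  have "trace P = (\<Sum>i\<in>UNIV. (P *v axis i 1) $ i)"
    by (simp add: trace_def matrix_vector_mult_def axis_def if_distrib cong: if_cong)
  also have "\<dots> = (\<Sum>b\<in>B. \<Sum>i\<in>UNIV. b $ i * f b (axis i 1))"
    by (subst sum.swap) (simp add: P_f mult.commute)
  also have "\<dots> = (\<Sum>b\<in>B. f b b)"
  proof (rule sum.cong[OF refl])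
    fix b
    have "(\<Sum>i\<in>UNIV. b $ i * f b (axis i 1)) = f b (\<Sum>i\<in>UNIV. b $ i *s axis i 1)"
      by (rule f_sum[OF finite, symmetric])
    then show "(\<Sum>i\<in>UNIV. b $ i * f b (axis i 1)) = f b b"
      by (simp only: basis_expansion)
  qed
  also have "\<dots> = (\<Sum>b\<in>B. 1)"
    using B(2) by (intro sum.cong) (auto simp: f_def Pb vec.representation_basis)
  finally show ?thesis using B(4) by simp
qed

section \<open>Pauli strings and Clifford generators\<close>

text \<open>A sum over all bit strings of a product over qubits factors into a product of sums over
  one bit.\<close>

lemma tensor_mult: "tensor A ** tensor B = tensor (\<lambda>q. A q ** B q)"
proof -
  have "(\<Sum>z\<in>UNIV. (\<Prod>q\<in>UNIV. A q $ x q $ z q) * (\<Prod>q\<in>UNIV. B q $ z q $ y q)) =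
      (\<Prod>q\<in>UNIV. \<Sum>b\<in>UNIV. A q $ x q $ b * B q $ b $ y q)" for x y
    by (simp add: prod_sum_PiE PiE_UNIV_domain prod.distrib)
  then show ?thesis by (simp add: tensor_def matrix_matrix_mult_def vec_eq_iff)
qed

lemma tensor_mat_1: "tensor (\<lambda>_. mat 1) = (mat 1 :: complex^('n::finite \<Rightarrow> bool)^('n \<Rightarrow> bool))"
  by (auto simp: tensor_def mat_def vec_eq_iff fun_eq_iff)

lemma adjoint_mat_tensor: "adjoint_mat (tensor A) = tensor (\<lambda>q. adjoint_mat (A q))"
  by (simp add: tensor_def adjoint_mat_def vec_eq_iff)

lemma tensor_anticommute:
  assumes p: "A p ** B p = - (B p ** A p)" and q: "\<And>q. q \<noteq> p \<Longrightarrow> A q ** B q = B q ** A q"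
  shows "tensor A ** tensor B = - (tensor B ** tensor A)"
proof -
  have "(\<Prod>q\<in>UNIV. (A q ** B q) $ x q $ y q) = - (\<Prod>q\<in>UNIV. (B q ** A q) $ x q $ y q)" for x y
    by (subst (1 2) prod.remove[of _ p]) (simp_all add: p q)
  then show ?thesis by (simp add: tensor_mult) (simp add: tensor_def vec_eq_iff)
qed

lemma pauli_adjoint:
  "adjoint_mat pauli_x = pauli_x" "adjoint_mat pauli_y = pauli_y" "adjoint_mat pauli_z = pauli_z"
  by (auto simp: adjoint_mat_def pauli_x_def pauli_y_def pauli_z_def vec_eq_iff)

lemma pauli_mult:
  "pauli_x ** pauli_x = mat 1" "pauli_y ** pauli_y = mat 1" "pauli_z ** pauli_z = mat 1"
  "pauli_x ** pauli_y = - (pauli_y ** pauli_x)"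
  "pauli_x ** pauli_z = - (pauli_z ** pauli_x)"
  "pauli_y ** pauli_z = - (pauli_z ** pauli_y)"
  by (auto simp: matrix_matrix_mult_def mat_def pauli_x_def pauli_y_def pauli_z_def vec_eq_iff UNIV_bool)

lemma pauli_string_mult_self:
  assumes "s ** s = mat 1"
  shows "pauli_string k s ** pauli_string k s = mat 1"
proof -
  have "pauli_string k s ** pauli_string k s = tensor (\<lambda>_. mat 1)"
    unfolding pauli_string_def tensor_mult
    by (rule arg_cong[where f = tensor]) (auto simp: assms pauli_mult)
  then show ?thesis by (simp add: tensor_mat_1)
qed

lemma adjoint_pauli_string:
  assumes "adjoint_mat s = s"
  shows "adjoint_mat (pauli_string k s) = pauli_string k s"
  unfolding pauli_string_def adjoint_mat_tensor
  by (rule arg_cong[where f = tensor]) (auto simp: assms pauli_adjoint adjoint_mat_mat)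

lemma qubit_at:
  assumes "1 \<le> k" "k \<le> CARD('n)"
  obtains p :: "'n::{finite,linorder}" where "qubit_pos p = k" "\<And>q :: 'n. q \<noteq> p \<Longrightarrow> qubit_pos q \<noteq> k"
proof -
  have "k \<in> range (qubit_pos :: 'n \<Rightarrow> nat)"
    using assms bij_betw_qubit_pos[where 'n = 'n] by (simp add: bij_betw_def)
  then obtain p :: 'n where "qubit_pos p = k" by blast
  moreover have "inj (qubit_pos :: 'n \<Rightarrow> nat)"
    using bij_betw_qubit_pos[where 'n = 'n] by (simp add: bij_betw_def)
  ultimately show ?thesis using that by (metis injD)
qed

text \<open>At position \<open>k\<close> the factors are \<open>s\<close> and
  \<open>pauli_z\<close>. Elsewhere they commute: before \<open>k\<close> both are
  \<open>pauli_z\<close>, after \<open>k\<close> the first is the identity.\<close>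

lemma pauli_string_anticommute_less:
  assumes "1 \<le> k" "k < l" "l \<le> CARD('n::{finite,linorder})"
    and s: "s ** pauli_z = - (pauli_z ** s)"
  shows "pauli_string k s ** pauli_string l t =
    - (pauli_string l t ** pauli_string k s :: complex^('n \<Rightarrow> bool)^('n \<Rightarrow> bool))"
proof -
  obtain p :: 'n where p: "qubit_pos p = k" "\<And>q :: 'n. q \<noteq> p \<Longrightarrow> qubit_pos q \<noteq> k"
    using qubit_at[of k, where 'n = 'n] assms by auto
  show ?thesis unfolding pauli_string_def
    by (rule tensor_anticommute[where p = p]) (use assms p in auto)
qed

lemma pauli_string_anticommute_same:
  assumes "1 \<le> k" "k \<le> CARD('n::{finite,linorder})" and s: "s ** t = - (t ** s)"
  shows "pauli_string k s ** pauli_string k t =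
    - (pauli_string k t ** pauli_string k s :: complex^('n \<Rightarrow> bool)^('n \<Rightarrow> bool))"
proof -
  obtain p :: 'n where p: "qubit_pos p = k" "\<And>q :: 'n. q \<noteq> p \<Longrightarrow> qubit_pos q \<noteq> k"
    using qubit_at[of k, where 'n = 'n] assms by auto
  show ?thesis unfolding pauli_string_def
    by (rule tensor_anticommute[where p = p]) (use assms p in auto)
qed

lemma clifford_gen_mult_self: "clifford_gen k ** clifford_gen k = mat 1"
  by (simp add: clifford_gen_def pauli_string_mult_self pauli_mult)

lemma adjoint_clifford_gen: "adjoint_mat (clifford_gen k) = clifford_gen k"
  by (simp add: clifford_gen_def adjoint_pauli_string pauli_adjoint)

lemma clifford_gen_anticommute:
  assumes "k \<in> {1..2 * CARD('n::{finite,linorder})}" "l \<in> {1..2 * CARD('n)}" "k \<noteq> l"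
  shows "clifford_gen k ** clifford_gen l =
    - (clifford_gen l ** clifford_gen k :: complex^('n \<Rightarrow> bool)^('n \<Rightarrow> bool))"
proof -
  \<comment> \<open>A generator is encoded by its position and its Pauli matrix; distinct such pairs
    anticommute, whatever the order of the positions.\<close>
  have less: "pauli_string i s ** pauli_string j t =
      - (pauli_string j t ** pauli_string i s :: complex^('n \<Rightarrow> bool)^('n \<Rightarrow> bool))"
    if "1 \<le> i" "i \<le> CARD('n)" "1 \<le> j" "j \<le> CARD('n)" "s \<in> {pauli_x, pauli_y}"
      "t \<in> {pauli_x, pauli_y}" "(i, s) \<noteq> (j, t)" for i j s t
  proof -
    consider "i < j" | "j < i" | "i = j" by linarith
    then show ?thesis
    proof cases
      case 1
      then show ?thesis using that pauli_string_anticommute_less[where 'n = 'n, of i j s t] pauli_mult by auto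
    next
      case 2
      then show ?thesis using that pauli_string_anticommute_less[where 'n = 'n, of j i t s] pauli_mult by auto
    next
      case 3
      then show ?thesis using that pauli_string_anticommute_same[where 'n = 'n, of i s t] pauli_mult by auto
    qed
  qed
  have "pauli_x \<noteq> pauli_y"
    by (auto simp: pauli_x_def pauli_y_def vec_eq_iff)
  then show ?thesis using assms
    by (auto simp: clifford_gen_def intro!: less)
qed

section \<open>Parity of bit strings and the projections onto the two semispinor spaces\<close>

definition parity_op :: "complex^('n::finite \<Rightarrow> bool)^('n \<Rightarrow> bool)"
  where "parity_op = tensor (\<lambda>_. pauli_z)"

lemma parity_op_nth:
  "parity_op $ x $ y = (if x = y then \<Prod>q\<in>UNIV. if x q then -1 else 1 else 0)"
  by (auto simp: parity_op_def tensor_def pauli_z_def fun_eq_iff)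

lemma adjoint_parity_op: "adjoint_mat parity_op = parity_op"
  by (simp add: parity_op_def adjoint_mat_tensor pauli_adjoint)

lemma clifford_gen_parity_op:
  assumes "k \<in> {1..2 * CARD('n::{finite,linorder})}"
  shows "clifford_gen k ** parity_op =
    - (parity_op ** clifford_gen k :: complex^('n \<Rightarrow> bool)^('n \<Rightarrow> bool))"
proof -
  have *: "pauli_string i s ** parity_op =
      - (parity_op ** pauli_string i s :: complex^('n \<Rightarrow> bool)^('n \<Rightarrow> bool))"
    if i: "1 \<le> i" "i \<le> CARD('n)" and s: "s ** pauli_z = - (pauli_z ** s)" for i s
  proof -
    obtain p :: 'n where p: "qubit_pos p = i" "\<And>q :: 'n. q \<noteq> p \<Longrightarrow> qubit_pos q \<noteq> i"
      using qubit_at[where 'n = 'n, OF i] by auto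
    show ?thesis unfolding pauli_string_def parity_op_def
      by (rule tensor_anticommute[where p = p]) (use p s in auto)
  qed
  show ?thesis using assms by (auto simp: clifford_gen_def pauli_mult intro!: *)
qed

text \<open>Conjugation by \<open>U\<^bsub>n+k\<^esub> U\<^sub>k\<close> is conjugation by \<open>\<sigma>\<^sub>z\<close> at position \<open>k\<close>.\<close>

lemma clifford_gen_pair_nth:
  fixes p :: "'n::{finite,linorder}"
  shows "(clifford_gen (CARD('n) + qubit_pos p) ** clifford_gen (qubit_pos p)) $ x $ y =
    (if x = y then if x p then \<i> else - \<i> else 0)"
proof -
  have pos: "1 \<le> qubit_pos p" "qubit_pos p \<le> CARD('n)"
    using bij_betw_qubit_pos[where 'n = 'n] by (auto simp: bij_betw_def)
  have inj: "qubit_pos q = qubit_pos p \<longleftrightarrow> q = p" for q :: 'n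
    using bij_betw_qubit_pos[where 'n = 'n] by (auto simp: bij_betw_def inj_eq)
  \<comment> \<open>The \<open>pauli_z\<close> factors before \<open>p\<close> square to the
    identity, and at \<open>p\<close> remains \<open>pauli_y ** pauli_x\<close>, which is
    \<open>- \<i>\<close> times \<open>pauli_z\<close>.\<close>
  have "clifford_gen (CARD('n) + qubit_pos p) ** clifford_gen (qubit_pos p) =
      tensor (\<lambda>q. if q = p then pauli_y ** pauli_x else mat 1)"
    using pos by (auto simp: clifford_gen_def pauli_string_def tensor_mult inj pauli_mult
        intro!: arg_cong[where f = tensor])
  moreover have "(\<Prod>q\<in>UNIV. (if q = p then pauli_y ** pauli_x else mat 1) $ x q $ y q) =
      (if x = y then if x p then \<i> else - \<i> else 0)"
  proof (cases "x = y")
    case True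
    have "(\<Prod>q\<in>UNIV. (if q = p then pauli_y ** pauli_x else mat 1) $ x q $ y q) =
      (\<Prod>q\<in>UNIV. if q = p then if x p then \<i> else - \<i> else 1)"
      using True by (intro prod.cong)
        (auto simp: mat_def matrix_matrix_mult_def pauli_x_def pauli_y_def UNIV_bool)
    then show ?thesis using True by simp
  next
    case False
    then obtain q where "x q \<noteq> y q" by auto
    then have "(if q = p then pauli_y ** pauli_x else mat 1) $ x q $ y q = 0"
      by (auto simp: mat_def matrix_matrix_mult_def pauli_x_def pauli_y_def UNIV_bool)
    then have "\<exists>q\<in>UNIV. (if q = p then pauli_y ** pauli_x else mat 1) $ x q $ y q = 0" by blast
    then show ?thesis using False by (subst prod_zero) auto
  qed
  ultimately show ?thesis by (simp add: tensor_def)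
qed

lemma parity_op_offdiag: "x \<noteq> y \<Longrightarrow> parity_op $ x $ y = 0"
  by (simp add: parity_op_nth)

lemma parity_op_diag: "parity_op $ x $ x = (-1) ^ card {q. x q}"
  by (simp add: parity_op_nth prod.If_cases)

fun opposite :: "chirality \<Rightarrow> chirality"
  where "opposite Positive = Negative" | "opposite Negative = Positive"

lemma opposite_opposite [simp]: "opposite (opposite s) = s"
  by (cases s) auto

lemma has_chirality_opposite: "has_chirality (opposite s) x \<longleftrightarrow> \<not> has_chirality s x"
  by (cases s) (auto simp: has_chirality_def)

lemma has_chirality_parity_op:
  "has_chirality s x \<longleftrightarrow> parity_op $ x $ x = (if s = Positive then 1 else -1)"
  by (cases "even (card {q. x q})"; cases s) (auto simp: has_chirality_def parity_op_diag)

lemma semispin_proj_is_orth_proj: "is_orth_proj (semispin_proj s) (semispin_space s)"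
  unfolding semispin_proj_def semispin_space_def by (rule is_orth_proj_orth_proj[OF vec.subspace_span])

text \<open>The projection is given by a description; an explicit diagonal matrix that is an
  orthogonal projection onto the same space must coincide with it.\<close>

lemma semispin_proj_nth:
  fixes x y :: "'n::finite \<Rightarrow> bool"
  shows "semispin_proj s $ x $ y = (if x = y \<and> has_chirality s x then 1 else 0)"
proof -
  define D :: "complex^('n \<Rightarrow> bool)^('n \<Rightarrow> bool)"
    where "D = (\<chi> x y. if x = y \<and> has_chirality s x then 1 else 0)"
  have D: "(D *v v) $ x = (if has_chirality s x then v $ x else 0)" for v x
    by (simp add: D_def matrix_vector_mult_def if_distribR if_distrib[of "\<lambda>c. c * _"] cong: if_cong)
  have "D *v (D *v v) = D *v v" for v
    by (simp add: vec_eq_iff D)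
  then have idem: "D ** D = D"
    by (simp add: matrix_eq flip: matrix_vector_mul_assoc)
  have adj: "adjoint_mat D = D"
    by (auto simp: adjoint_mat_def D_def vec_eq_iff)
  have "range ((*v) D) = (semispin_space s :: (complex^('n \<Rightarrow> bool)) set)"
  proof (intro set_eqI iffI)
    fix v :: "complex^('n \<Rightarrow> bool)" assume "v \<in> range ((*v) D)"
    then obtain w where w: "v = D *v w" by blast
    have "v = (\<Sum>x\<in>UNIV. (D *v w) $ x *s axis x 1)"
      by (simp add: w basis_expansion)
    also have "\<dots> \<in> semispin_space s"
      unfolding semispin_space_def
    proof (rule vec.span_sum)
      fix x
      show "(D *v w) $ x *s axis x 1 \<in> vec.span {axis x 1 |x. has_chirality s x}"
      proof (cases "has_chirality s x")
        case True
        then show ?thesis by (intro vec.span_scale vec.span_base) blast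
      qed (simp add: D vec.span_zero)
    qed
    finally show "v \<in> semispin_space s" .
  next
    fix v :: "complex^('n \<Rightarrow> bool)" assume "v \<in> semispin_space s"
    then have "D *v v = v"
      unfolding semispin_space_def
    proof (induction v rule: vec.span_induct)
      case base
      show ?case
        by (simp add: vec.subspace_def matrix_vector_right_distrib vector_scalar_commute)
    next
      case (step v)
      then obtain x where "v = axis x 1" "has_chirality s x" by blast
      then show ?case by (auto simp: vec_eq_iff D axis_def)
    qed
    then show "v \<in> range ((*v) D)" by (metis rangeI)
  qed
  then have "is_orth_proj D (semispin_space s)"
    using idem adj by (simp add: is_orth_proj_def)
  then have "semispin_proj s = D"
    by (rule is_orth_proj_unique[OF semispin_proj_is_orth_proj])
  then show ?thesis by (simp add: D_def)
qed

lemma semispin_proj_mult_self: "semispin_proj s ** semispin_proj s = semispin_proj s"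
  by (meson is_orth_proj_def semispin_proj_is_orth_proj)

lemma adjoint_semispin_proj: "adjoint_mat (semispin_proj s) = semispin_proj s"
  by (meson is_orth_proj_def semispin_proj_is_orth_proj)

lemma parity_op_semispin_proj:
  "parity_op ** semispin_proj s = (if s = Positive then 1 else -1) *\<^sub>R semispin_proj s"
  by (auto simp: vec_eq_iff diagonal_mult_nth parity_op_offdiag semispin_proj_nth
      has_chirality_parity_op)

text \<open>Both projections are diagonal, so entries are compared. Anticommutation with
  \<open>parity_op\<close> shows that a nonzero entry of a generator joins bit strings of opposite
  parity.\<close>

lemma clifford_gen_semispin_proj:
  assumes "k \<in> {1..2 * CARD('n::{finite,linorder})}"
  shows "clifford_gen k ** semispin_proj s =
    semispin_proj (opposite s) ** (clifford_gen k :: complex^('n \<Rightarrow> bool)^('n \<Rightarrow> bool))"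
proof -
  have "clifford_gen k $ x $ y * semispin_proj s $ y $ y =
      semispin_proj (opposite s) $ x $ x * clifford_gen k $ x $ y" for x y :: "'n \<Rightarrow> bool"
  proof (cases "clifford_gen k $ x $ y = 0")
    case False
    have "(clifford_gen k ** parity_op) $ x $ y = - (parity_op ** clifford_gen k) $ x $ y"
      using clifford_gen_parity_op[OF assms] by simp
    then have "clifford_gen k $ x $ y * parity_op $ y $ y =
        - (parity_op $ x $ x * clifford_gen k $ x $ y)"
      by (simp add: diagonal_mult_nth parity_op_offdiag)
    then have "clifford_gen k $ x $ y * parity_op $ y $ y = clifford_gen k $ x $ y * - parity_op $ x $ x"
      by (simp only: mult_minus_right mult.commute[of "parity_op $ x $ x"])
    then have "parity_op $ y $ y = - parity_op $ x $ x"
      by (rule mult_left_cancel[OF False, THEN iffD1])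
    then have "has_chirality (opposite s) x \<longleftrightarrow> has_chirality s y"
      by (cases s; cases "even (card {q. x q})") (simp_all add: has_chirality_parity_op parity_op_diag)
    then show ?thesis by (simp add: semispin_proj_nth)
  qed simp
  then show ?thesis
    by (simp add: vec_eq_iff diagonal_mult_nth semispin_proj_nth)
qed

text \<open>Conjugation by \<open>U_1\<close> exchanges the two projections, so their traces agree,
  and these add up to the number of bit strings.\<close>

lemma trace_semispin_proj:
  "trace (semispin_proj s :: complex^('n::{finite,linorder} \<Rightarrow> bool)^('n \<Rightarrow> bool)) = 2 ^ (CARD('n) - 1)"
proof -
  have pos: "CARD('n) > 0" by simp
  let ?P = "\<lambda>s. semispin_proj s :: complex^('n \<Rightarrow> bool)^('n \<Rightarrow> bool)"
  let ?U = "clifford_gen 1 :: complex^('n \<Rightarrow> bool)^('n \<Rightarrow> bool)"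
  have "trace (?P s) = trace (?U ** (?U ** ?P s))"
    by (simp add: matrix_mul_assoc clifford_gen_mult_self)
  also have "\<dots> = trace (?U ** ?P s ** ?U)"
    by (rule trace_mul_sym)
  also have "?U ** ?P s ** ?U = ?P (opposite s) ** (?U ** ?U)"
    using pos by (subst clifford_gen_semispin_proj) (auto simp: matrix_mul_assoc)
  finally have "trace (?P (opposite s)) = trace (?P s)"
    by (simp add: clifford_gen_mult_self)
  moreover have "trace (?P s) + trace (?P (opposite s)) = 2 ^ CARD('n)"
  proof -
    have "trace (?P s) + trace (?P (opposite s)) = (\<Sum>x\<in>(UNIV :: ('n \<Rightarrow> bool) set). 1)"
      unfolding trace_def sum.distrib[symmetric]
      by (rule sum.cong) (auto simp: semispin_proj_nth has_chirality_opposite)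
    then show ?thesis by (simp add: card_fun)
  qed
  moreover have "(2 :: complex) ^ CARD('n) = 2 * 2 ^ (CARD('n) - 1)"
    using pos by (cases "CARD('n)") auto
  ultimately show ?thesis by simp
qed

section \<open>Conjugation by the Clifford generators\<close>

text \<open>This is the map \<open>T_k\<close> of the introductory remark; a generator is its own
  inverse and adjoint.\<close>

definition clifford_conj ::
    "nat \<Rightarrow> complex^('n::{finite,linorder} \<Rightarrow> bool)^('n \<Rightarrow> bool) \<Rightarrow> complex^('n \<Rightarrow> bool)^('n \<Rightarrow> bool)"
  where "clifford_conj k A = clifford_gen k ** A ** clifford_gen k"

lemma linear_clifford_conj: "linear (clifford_conj k)"
  by (rule linearI)
    (simp_all add: clifford_conj_def matrix_add_ldistrib matrix_add_rdistrib matrix_mult_scaleR)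

lemma clifford_gen_cancel: "clifford_gen k ** (clifford_gen k ** A) = A"
  by (simp add: matrix_mul_assoc clifford_gen_mult_self)

lemma clifford_conj_involution: "clifford_conj k (clifford_conj k A) = A"
  by (simp add: clifford_conj_def clifford_gen_cancel clifford_gen_mult_self flip: matrix_mul_assoc)

lemma clifford_conj_commute:
  fixes A :: "complex^('n::{finite,linorder} \<Rightarrow> bool)^('n \<Rightarrow> bool)"
  assumes "k \<in> {1..2 * CARD('n)}" "l \<in> {1..2 * CARD('n)}"
  shows "clifford_conj k (clifford_conj l A) = clifford_conj l (clifford_conj k A)"
proof (cases "k = l")
  case False
  let ?U = "\<lambda>k. clifford_gen k :: complex^('n \<Rightarrow> bool)^('n \<Rightarrow> bool)"
  have "clifford_conj k (clifford_conj l A) = (?U k ** ?U l) ** A ** (?U l ** ?U k)"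
    by (simp add: clifford_conj_def matrix_mul_assoc)
  also have "\<dots> = (?U l ** ?U k) ** A ** (?U k ** ?U l)"
    using clifford_gen_anticommute[OF assms False] by (simp add: matrix_mult_uminus)
  also have "\<dots> = clifford_conj l (clifford_conj k A)"
    by (simp add: clifford_conj_def matrix_mul_assoc)
  finally show ?thesis .
qed simp

lemma inner_clifford_conj: "clifford_conj k A \<bullet> B = A \<bullet> clifford_conj k B"
proof -
  let ?U = "clifford_gen k"
  have "trace (?U ** (A ** ?U ** adjoint_mat B)) = trace ((A ** ?U ** adjoint_mat B) ** ?U)"
    by (rule trace_mul_sym)
  then show ?thesis
    by (simp add: inner_matrix clifford_conj_def adjoint_mat_mult adjoint_clifford_gen matrix_mul_assoc)
qed

section \<open>The sum of all conjugations and its lower bound on even operators\<close>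

lemma linear_sum_clifford_conj: "linear (\<lambda>A. \<Sum>k\<in>K. clifford_conj k A)"
  by (intro linear_compose_sum ballI linear_clifford_conj)

lemma inner_sum_clifford_conj:
  "(\<Sum>k\<in>K. clifford_conj k A) \<bullet> B = A \<bullet> (\<Sum>k\<in>K. clifford_conj k B)"
  by (simp add: inner_sum_left inner_sum_right inner_clifford_conj)

text \<open>These are the block diagonal matrices for the splitting into even and odd bit strings.
  They serve as the invariant subspace \<open>W\<close> in the lemmas on inner product
  spaces.\<close>

definition even_ops :: "(complex^('n::finite \<Rightarrow> bool)^('n \<Rightarrow> bool)) set"
  where "even_ops = {A. parity_op ** A = A ** parity_op}"

lemma subspace_even_ops: "subspace even_ops"
  by (simp add: subspace_def even_ops_def matrix_add_ldistrib matrix_add_rdistrib matrix_mult_scaleR)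

lemma clifford_conj_even_ops:
  fixes A :: "complex^('n::{finite,linorder} \<Rightarrow> bool)^('n \<Rightarrow> bool)"
  assumes k: "k \<in> {1..2 * CARD('n)}" and A: "A \<in> even_ops"
  shows "clifford_conj k A \<in> even_ops"
proof -
  let ?U = "clifford_gen k :: complex^('n \<Rightarrow> bool)^('n \<Rightarrow> bool)"
  have Z: "parity_op ** ?U = - (?U ** parity_op)"
    using clifford_gen_parity_op[OF k] by simp
  have "parity_op ** (?U ** A ** ?U) = - (?U ** (parity_op ** A) ** ?U)"
    by (simp add: matrix_mul_assoc Z matrix_mult_uminus)
  also have "\<dots> = - (?U ** A ** (parity_op ** ?U))"
    using A by (simp add: even_ops_def matrix_mul_assoc)
  also have "\<dots> = ?U ** A ** ?U ** parity_op"
    by (simp add: Z matrix_mult_uminus matrix_mul_assoc)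
  finally show ?thesis by (simp add: even_ops_def clifford_conj_def)
qed

text \<open>The signs have product 1, so the set \<open>M\<close> of indices with sign -1 has even
  size. The sum is \<open>2 * (n - card M)\<close>, which cannot vanish for odd
  \<open>n\<close>.\<close>

lemma clifford_conj_eigenvalues:
  fixes w :: "complex^('n::{finite,linorder} \<Rightarrow> bool)^('n \<Rightarrow> bool)"
  assumes n: "odd CARD('n)" and w: "w \<in> even_ops" "w \<noteq> 0"
    and e: "\<And>k. k \<in> {1..2 * CARD('n)} \<Longrightarrow> e k = 1 \<or> e k = (-1 :: real)"
    and eig: "\<And>k. k \<in> {1..2 * CARD('n)} \<Longrightarrow> clifford_conj k w = e k *\<^sub>R w"
  shows "4 \<le> (\<Sum>k\<in>{1..2 * CARD('n)}. e k)\<^sup>2"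
proof -
  define K where "K = {1..2 * CARD('n)}"
  define f :: "bool \<Rightarrow> real" where "f b = (if b then -1 else 1)" for b
  have ff: "f b * f b = 1" for b by (simp add: f_def)
  obtain x y where xy: "w $ x $ y \<noteq> 0"
    using w(2) by (auto simp: vec_eq_iff)
  \<comment> \<open>Conjugation by the diagonal matrix \<open>D\<close> scales the entry at
    \<open>x\<close>, \<open>y\<close> by a sign read off from the bits at \<open>p\<close>; the
    eigenvalue equations scale it by the product of two signs. The entry is nonzero, so the two
    agree.\<close>
  have pair: "e (qubit_pos p) * e (CARD('n) + qubit_pos p) = f (x p) * f (y p)" for p :: 'n
  proof -
    let ?k = "qubit_pos p" and ?l = "CARD('n) + qubit_pos p"
    have pos: "?k \<in> {1..CARD('n)}"
      using bij_betw_qubit_pos[where 'n = 'n] by (auto simp: bij_betw_def)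
    define D :: "complex^('n \<Rightarrow> bool)^('n \<Rightarrow> bool)"
      where "D = clifford_gen ?l ** clifford_gen ?k"
    have D: "D $ u $ v = (if u = v then if u p then \<i> else - \<i> else 0)" for u v
      by (simp add: D_def clifford_gen_pair_nth)
    have adj: "adjoint_mat D $ u $ v = (if u = v then if u p then - \<i> else \<i> else 0)" for u v
      by (simp add: adjoint_mat_def D)
    have "D ** w ** adjoint_mat D = clifford_conj ?l (clifford_conj ?k w)"
      by (simp add: D_def adjoint_mat_mult adjoint_clifford_gen clifford_conj_def matrix_mul_assoc)
    also have "\<dots> = (e ?k * e ?l) *\<^sub>R w"
      using eig[of ?k] eig[of ?l] pos by (simp add: linear_scale[OF linear_clifford_conj])
    finally have "(D ** w ** adjoint_mat D) $ x $ y = (e ?k * e ?l) *\<^sub>R (w $ x $ y)"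
      by simp
    moreover have "(D ** w ** adjoint_mat D) $ x $ y = (f (x p) * f (y p)) *\<^sub>R (w $ x $ y)"
      by (subst diagonal_mult_nth(2), simp add: adj, subst diagonal_mult_nth(1), simp add: D)
        (simp add: D adj f_def ac_simps)
    ultimately show ?thesis using xy by (metis scaleR_cancel_right)
  qed
  \<comment> \<open>Since \<open>w\<close> commutes with the parity operator, its nonzero entry
    joins bit strings of equal parity.\<close>
  have sign: "(\<Prod>p\<in>UNIV. f (x p)) * (\<Prod>p\<in>UNIV. f (y p)) = 1"
  proof -
    have Z: "parity_op $ u $ u = complex_of_real (\<Prod>p\<in>UNIV. f (u p))" for u :: "'n \<Rightarrow> bool"
      unfolding parity_op_nth of_real_prod by (simp, rule prod.cong) (auto simp: f_def)
    have "(parity_op ** w) $ x $ y = (w ** parity_op) $ x $ y"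
      using w(1) by (simp add: even_ops_def)
    then have "parity_op $ x $ x = parity_op $ y $ y"
      using xy by (simp add: diagonal_mult_nth parity_op_offdiag mult.commute)
    then have "(\<Prod>p\<in>UNIV. f (x p)) = (\<Prod>p\<in>UNIV. f (y p))"
      by (simp only: Z of_real_eq_iff)
    moreover have "(\<Prod>p\<in>UNIV. f (y p)) * (\<Prod>p\<in>UNIV. f (y p)) = 1"
      by (simp add: ff flip: prod.distrib)
    ultimately show ?thesis by simp
  qed
  \<comment> \<open>The factors with indices \<open>k\<close> and \<open>n + k\<close> are grouped,
    one pair for each qubit.\<close>
  have "(\<Prod>k\<in>K. e k) = (\<Prod>k\<in>{1..CARD('n)}. e k) * (\<Prod>k\<in>{CARD('n) + 1..CARD('n) + CARD('n)}. e k)"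
    unfolding K_def mult_2 by (rule prod.ub_add_nat) simp
  also have "(\<Prod>k\<in>{CARD('n) + 1..CARD('n) + CARD('n)}. e k) = (\<Prod>k\<in>{1..CARD('n)}. e (CARD('n) + k))"
    using prod.shift_bounds_cl_nat_ivl[of e 1 "CARD('n)" "CARD('n)"] by (simp add: add.commute)
  also have "(\<Prod>k\<in>{1..CARD('n)}. e k) * \<dots> = (\<Prod>k\<in>{1..CARD('n)}. e k * e (CARD('n) + k))"
    by (rule prod.distrib[symmetric])
  also have "\<dots> = (\<Prod>p\<in>UNIV. e (qubit_pos (p :: 'n)) * e (CARD('n) + qubit_pos p))"
    by (rule prod.reindex_bij_betw[OF bij_betw_qubit_pos, symmetric])
  also have "\<dots> = 1" using sign by (simp add: pair prod.distrib)
  finally have prod: "(\<Prod>k\<in>K. e k) = 1" .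
  define M where "M = {k \<in> K. e k = -1}"
  have fin: "finite K" by (simp add: K_def)
  have e': "e k = (if k \<in> M then -1 else 1)" if "k \<in> K" for k
    using e[of k] that by (auto simp: M_def K_def)
  have KM: "K \<inter> M = M" by (auto simp: M_def)
  have "(\<Prod>k\<in>K. e k) = (-1) ^ card M"
    by (simp add: e' prod.If_cases fin KM cong: prod.cong)
  then have even: "even (card M)"
    using prod by (metis neg_one_odd_power one_neq_neg_one)
  have "(\<Sum>k\<in>K. e k) = (\<Sum>k\<in>K. 1 - 2 * (if k \<in> M then 1 else 0))"
    by (rule sum.cong) (auto simp: e')
  also have "\<dots> = real (card K) - 2 * real (card M)"
    by (simp add: sum_subtractf fin KM flip: sum_distrib_left sum.inter_restrict)
  also have "\<dots> = real_of_int (2 * (int CARD('n) - int (card M)))"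
    by (simp add: K_def)
  finally have sum: "(\<Sum>k\<in>K. e k) = real_of_int (2 * (int CARD('n) - int (card M)))" .
  have "int CARD('n) - int (card M) \<noteq> 0"
    using n even by auto
  then have "1 \<le> \<bar>int CARD('n) - int (card M)\<bar>" by linarith
  then have "1 \<le> (int CARD('n) - int (card M))\<^sup>2"
    by (metis abs_1 abs_le_square_iff one_power2)
  then have "4 \<le> (2 * (int CARD('n) - int (card M)))\<^sup>2"
    unfolding power_mult_distrib by simp
  then have "real_of_int 4 \<le> real_of_int ((2 * (int CARD('n) - int (card M)))\<^sup>2)"
    by (simp only: of_int_le_iff)
  then show ?thesis unfolding sum[unfolded K_def] by simp
qed

text \<open>For even \<open>n\<close> the parity argument leaves a vanishing sum of signs open, so
  the constant is 0 there.\<close>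

lemma sum_clifford_conj_lower_bound:
  fixes A :: "complex^('n::{finite,linorder} \<Rightarrow> bool)^('n \<Rightarrow> bool)"
  assumes A: "A \<in> even_ops"
  shows "(if odd CARD('n) then 4 else 0) * (A \<bullet> A) \<le>
    (\<Sum>k\<in>{1..2 * CARD('n)}. clifford_conj k A) \<bullet> (\<Sum>k\<in>{1..2 * CARD('n)}. clifford_conj k A)"
proof (rule sum_involutions_lower_bound[where W = even_ops])
  fix e and v :: "complex^('n \<Rightarrow> bool)^('n \<Rightarrow> bool)"
  assume "v \<in> even_ops" "v \<noteq> 0"
    "\<And>k. k \<in> {1..2 * CARD('n)} \<Longrightarrow> e k = 1 \<or> e k = (-1 :: real)"
    "\<And>k. k \<in> {1..2 * CARD('n)} \<Longrightarrow> clifford_conj k v = e k *\<^sub>R v"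
  then show "(if odd CARD('n) then 4 else 0) \<le> (\<Sum>k\<in>{1..2 * CARD('n)}. e k)\<^sup>2"
    using clifford_conj_eigenvalues[of v e] by auto
qed (use A in \<open>auto simp: linear_clifford_conj clifford_conj_involution inner_clifford_conj
    subspace_even_ops intro: clifford_conj_commute clifford_conj_even_ops\<close>)

section \<open>Products of two generators\<close>

text \<open>Degenerate index pairs stand for the identity, so that \<open>P\<^sub>\<plusminus>\<close> and the operators
  \<open>\<i> P\<^sub>\<plusminus> U\<^sub>k U\<^sub>l\<close> form one family.\<close>

fun pair_support :: "nat \<times> nat \<Rightarrow> nat set"
  where "pair_support (k, l) = (if k = l then {} else {k, l})"

fun pair_op :: "nat \<times> nat \<Rightarrow> complex^('n::{finite,linorder} \<Rightarrow> bool)^('n \<Rightarrow> bool)"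
  where "pair_op (k, l) = (if k = l then mat 1 else mat \<i> ** clifford_gen k ** clifford_gen l)"

definition pair_sign :: "nat \<Rightarrow> nat \<times> nat \<Rightarrow> real"
  where "pair_sign i v = (if i \<in> pair_support v then -1 else 1)"

text \<open>Moving \<open>U_i\<close> past \<open>U_k U_l\<close> costs a sign for each factor other
  than \<open>U_i\<close>: two signs cancel for \<open>i\<close> outside the support, one remains
  for \<open>i\<close> inside it.\<close>

lemma clifford_gen_pair_op:
  assumes i: "i \<in> {1..2 * CARD('n::{finite,linorder})}" and v: "pair_support v \<subseteq> {1..2 * CARD('n)}"
  shows "clifford_gen i ** pair_op v =
    pair_sign i v *\<^sub>R (pair_op v ** (clifford_gen i :: complex^('n \<Rightarrow> bool)^('n \<Rightarrow> bool)))"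
proof (cases v)
  case (Pair k l)
  let ?U = "\<lambda>k. clifford_gen k :: complex^('n \<Rightarrow> bool)^('n \<Rightarrow> bool)"
  show ?thesis
  proof (cases "k = l")
    case True
    then show ?thesis by (simp add: Pair pair_sign_def)
  next
    case False
    have anti: "?U a ** ?U b = - (?U b ** ?U a)"
      if "a \<in> {i, k, l}" "b \<in> {i, k, l}" "a \<noteq> b" for a b
      by (rule clifford_gen_anticommute) (use that i v False Pair in auto)
    have "?U i ** (?U k ** ?U l) = pair_sign i v *\<^sub>R (?U k ** ?U l ** ?U i)"
    proof (cases "i = k \<or> i = l")
      case True
      then show ?thesis
      proof
        assume [simp]: "i = k"
        have "?U k ** ?U l ** ?U k = - (?U k ** (?U k ** ?U l))"
          using anti[of l k] False by (simp add: matrix_mult_uminus flip: matrix_mul_assoc)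
        then show ?thesis using False by (simp add: Pair pair_sign_def)
      next
        assume [simp]: "i = l"
        have "?U l ** (?U k ** ?U l) = - (?U k ** ?U l ** ?U l)"
          using anti[of l k] False by (simp add: matrix_mult_uminus matrix_mul_assoc)
        then show ?thesis using False by (simp add: Pair pair_sign_def)
      qed
    next
      case i: False
      have "?U i ** (?U k ** ?U l) = - (?U k ** (?U i ** ?U l))"
        using anti[of i k] i by (simp add: matrix_mult_uminus matrix_mul_assoc)
      also have "\<dots> = ?U k ** ?U l ** ?U i"
        using anti[of i l] i by (simp add: matrix_mult_uminus flip: matrix_mul_assoc)
      finally show ?thesis using i False by (simp add: Pair pair_sign_def)
    qed
    then have "mat \<i> ** (?U i ** (?U k ** ?U l)) = mat \<i> ** (pair_sign i v *\<^sub>R (?U k ** ?U l ** ?U i))"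
      by simp
    moreover have "mat \<i> ** (?U i ** (?U k ** ?U l)) = ?U i ** pair_op v"
      using False by (simp add: Pair matrix_mul_assoc mat_commute[of "?U i"])
    ultimately show ?thesis
      using False by (simp add: Pair matrix_mult_scaleR matrix_mul_assoc)
  qed
qed

text \<open>A product of two distinct generators is skew-adjoint by anticommutation; the factor
  \<open>\<i>\<close> makes it self-adjoint.\<close>

lemma adjoint_pair_op:
  assumes "pair_support v \<subseteq> {1..2 * CARD('n::{finite,linorder})}"
  shows "adjoint_mat (pair_op v) = (pair_op v :: complex^('n \<Rightarrow> bool)^('n \<Rightarrow> bool))"
proof (cases v)
  case (Pair k l)
  let ?U = "\<lambda>k. clifford_gen k :: complex^('n \<Rightarrow> bool)^('n \<Rightarrow> bool)"
  show ?thesis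
  proof (cases "k = l")
    case False
    have "adjoint_mat (pair_op v) = mat (- \<i>) ** (?U l ** ?U k)"
      using False by (simp add: Pair adjoint_mat_mult adjoint_clifford_gen adjoint_mat_mat
          mat_commute matrix_mul_assoc)
    also have "\<dots> = mat (- \<i>) ** (- (?U k ** ?U l))"
      by (subst clifford_gen_anticommute) (use assms False Pair in auto)
    also have "\<dots> = pair_op v"
      using False by (simp add: Pair mat_uminus_mult matrix_mult_uminus matrix_mul_assoc)
    finally show ?thesis .
  qed (simp add: Pair adjoint_mat_mat)
qed

lemma pair_op_mult_adjoint: "pair_op v ** adjoint_mat (pair_op v) = mat 1"
proof (cases v)
  case (Pair k l)
  show ?thesis
  proof (cases "k = l")
    case False
    have "pair_op v ** adjoint_mat (pair_op v) = mat \<i> ** (clifford_gen k ** (clifford_gen l **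
        (clifford_gen l ** (clifford_gen k ** mat (- \<i>)))))"
      using False by (simp add: Pair adjoint_mat_mult adjoint_clifford_gen adjoint_mat_mat
          matrix_mul_assoc)
    also have "\<dots> = mat 1"
      by (simp add: clifford_gen_cancel mat_mult_mat)
    finally show ?thesis .
  qed (simp add: Pair adjoint_mat_mat)
qed

lemma parity_op_pair_op:
  assumes "pair_support v \<subseteq> {1..2 * CARD('n::{finite,linorder})}"
  shows "parity_op ** pair_op v = pair_op v ** (parity_op :: complex^('n \<Rightarrow> bool)^('n \<Rightarrow> bool))"
proof (cases v)
  case (Pair k l)
  let ?U = "\<lambda>k. clifford_gen k :: complex^('n \<Rightarrow> bool)^('n \<Rightarrow> bool)"
  show ?thesis
  proof (cases "k = l")
    case False
    have Z: "parity_op ** ?U i = - (?U i ** parity_op)" if "i \<in> {k, l}" for i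
      by (subst clifford_gen_parity_op) (use assms False Pair that in auto)
    have "parity_op ** (?U k ** ?U l) = - (?U k ** (parity_op ** ?U l))"
      by (simp add: matrix_mul_assoc Z[of k] matrix_mult_uminus)
    also have "\<dots> = ?U k ** ?U l ** parity_op"
      by (simp add: Z matrix_mult_uminus flip: matrix_mul_assoc)
    finally have "mat \<i> ** (parity_op ** (?U k ** ?U l)) = mat \<i> ** (?U k ** ?U l ** parity_op)"
      by simp
    then show ?thesis
      using False by (simp add: Pair matrix_mul_assoc mat_commute[of parity_op])
  qed (simp add: Pair)
qed

text \<open>Passing the projection flips the chirality, passing \<open>pair_op v\<close> gives the
  sign. Hence compositions of two conjugations act by scalars.\<close>

lemma clifford_conj_semispin_pair:
  fixes v :: "nat \<times> nat"
  assumes i: "i \<in> {1..2 * CARD('n::{finite,linorder})}" and v: "pair_support v \<subseteq> {1..2 * CARD('n)}"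
  shows "clifford_conj i (semispin_proj s ** pair_op v) =
    pair_sign i v *\<^sub>R (semispin_proj (opposite s) ** pair_op v :: complex^('n \<Rightarrow> bool)^('n \<Rightarrow> bool))"
proof -
  let ?U = "clifford_gen i :: complex^('n \<Rightarrow> bool)^('n \<Rightarrow> bool)"
  let ?J = "pair_op v :: complex^('n \<Rightarrow> bool)^('n \<Rightarrow> bool)"
  have "clifford_conj i (semispin_proj s ** ?J) = (?U ** semispin_proj s) ** ?J ** ?U"
    by (simp add: clifford_conj_def matrix_mul_assoc)
  also have "\<dots> = semispin_proj (opposite s) ** (?U ** ?J) ** ?U"
    by (simp add: clifford_gen_semispin_proj[OF i] matrix_mul_assoc)
  also have "\<dots> = pair_sign i v *\<^sub>R (semispin_proj (opposite s) ** ?J ** (?U ** ?U))"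
    by (simp add: clifford_gen_pair_op[OF i v] matrix_mult_scaleR matrix_mul_assoc)
  finally show ?thesis by (simp add: clifford_gen_mult_self)
qed

text \<open>Each application of the sum flips the chirality and multiplies by the sum of the
  \<open>2n\<close> signs, those in the support being -1; the second application restores the
  chirality.\<close>

lemma sum_clifford_conj_twice_semispin_pair:
  fixes v :: "nat \<times> nat" and s :: chirality
  assumes v: "pair_support v \<subseteq> {1..2 * CARD('n::{finite,linorder})}"
  defines "B \<equiv> semispin_proj s ** pair_op v :: complex^('n \<Rightarrow> bool)^('n \<Rightarrow> bool)"
  shows "(\<Sum>i\<in>{1..2 * CARD('n)}. clifford_conj i (\<Sum>j\<in>{1..2 * CARD('n)}. clifford_conj j B)) =
    (2 * real CARD('n) - 2 * real (card (pair_support v)))\<^sup>2 *\<^sub>R B"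
proof -
  define K where "K = {1..2 * CARD('n)}"
  have fin: "finite K" by (simp add: K_def)
  have "(\<Sum>i\<in>K. pair_sign i v) = (\<Sum>i\<in>K. 1 - 2 * (if i \<in> pair_support v then 1 else 0))"
    by (rule sum.cong) (auto simp: pair_sign_def)
  also have "\<dots> = real (card K) - 2 * real (card (K \<inter> pair_support v))"
    by (simp add: sum_subtractf fin flip: sum_distrib_left sum.inter_restrict)
  also have "K \<inter> pair_support v = pair_support v"
    using v by (auto simp: K_def)
  finally have sum: "(\<Sum>i\<in>K. pair_sign i v) = 2 * real CARD('n) - 2 * real (card (pair_support v))"
    by (simp add: K_def)
  have conj: "(\<Sum>j\<in>K. clifford_conj j (semispin_proj t ** pair_op v)) =
      (\<Sum>j\<in>K. pair_sign j v) *\<^sub>R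
        (semispin_proj (opposite t) ** pair_op v :: complex^('n \<Rightarrow> bool)^('n \<Rightarrow> bool))" for t
    using v by (simp add: clifford_conj_semispin_pair K_def scaleR_sum_left)
  have "(\<Sum>i\<in>K. clifford_conj i (\<Sum>j\<in>K. clifford_conj j B)) =
      (\<Sum>i\<in>K. clifford_conj i ((\<Sum>j\<in>K. pair_sign j v) *\<^sub>R (semispin_proj (opposite s) ** pair_op v)))"
    by (simp add: B_def conj)
  also have "\<dots> = (\<Sum>j\<in>K. pair_sign j v) *\<^sub>R
      (\<Sum>i\<in>K. clifford_conj i (semispin_proj (opposite s) ** pair_op v))"
    by (simp only: linear_scale[OF linear_clifford_conj] scaleR_sum_right)
  also have "\<dots> = ((\<Sum>j\<in>K. pair_sign j v) * (\<Sum>j\<in>K. pair_sign j v)) *\<^sub>R B"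
    by (simp only: conj opposite_opposite scaleR_scaleR B_def)
  finally show ?thesis
    unfolding sum power2_eq_square by (simp only: K_def)
qed

text \<open>Distinct members are separated by a self-adjoint \<open>T_i T_j\<close> acting on them
  with different signs; two conjugations preserve the chirality. The squared norm is the trace of
  the projection, as \<open>pair_op v\<close> is unitary.\<close>

lemma inner_semispin_pair:
  fixes v w :: "nat \<times> nat" and s :: chirality
  assumes n: "4 \<le> CARD('n::{finite,linorder})"
    and v: "pair_support v \<subseteq> {1..2 * CARD('n)}" and w: "pair_support w \<subseteq> {1..2 * CARD('n)}"
    and inj: "v \<noteq> w \<Longrightarrow> pair_support v \<noteq> pair_support w"
  defines "B \<equiv> \<lambda>v. semispin_proj s ** pair_op v :: complex^('n \<Rightarrow> bool)^('n \<Rightarrow> bool)"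
  shows "B v \<bullet> B w = (if v = w then 2 ^ (CARD('n) - 1) else 0)"
proof (cases "v = w")
  case True
  have "B v ** adjoint_mat (B v) =
      semispin_proj s ** (pair_op v ** adjoint_mat (pair_op v)) ** semispin_proj s"
    by (simp add: B_def adjoint_mat_mult adjoint_semispin_proj matrix_mul_assoc)
  also have "\<dots> = semispin_proj s"
    by (simp add: pair_op_mult_adjoint semispin_proj_mult_self)
  finally have "B v \<bullet> B v = Re (2 ^ (CARD('n) - 1))"
    by (simp add: inner_matrix trace_semispin_proj)
  also have "\<dots> = 2 ^ (CARD('n) - 1)"
    by (metis Re_complex_of_real of_real_numeral of_real_power)
  finally show ?thesis using True by simp
next
  case False
  have card: "card (pair_support u) \<le> 2" for u
    by (cases u) (auto simp: card_insert_if)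
  have fin: "finite (pair_support u)" for u
    by (cases u) auto
  obtain i where "i \<in> pair_support v \<longleftrightarrow> i \<notin> pair_support w"
    using inj[OF False] by blast
  then have i: "i \<in> {1..2 * CARD('n)}" "pair_sign i v \<noteq> pair_sign i w"
    using v w by (auto simp: pair_sign_def split: if_splits)
  \<comment> \<open>The two supports have at most 4 elements together, fewer than the
    \<open>2n\<close> indices. An index \<open>j\<close> outside both contributes the sign 1 on
    either side.\<close>
  have "card (pair_support v \<union> pair_support w) < card {1..2 * CARD('n)}"
    using card_Un_le[of "pair_support v" "pair_support w"] card[of v] card[of w] n by simp
  then obtain j where j: "j \<in> {1..2 * CARD('n)}" "j \<notin> pair_support v" "j \<notin> pair_support w"
    using card_mono[of "pair_support v \<union> pair_support w" "{1..2 * CARD('n)}"] fin by fastforce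
  have T: "clifford_conj a (clifford_conj b (B u)) = (pair_sign a u * pair_sign b u) *\<^sub>R B u"
    if "a \<in> {i, j}" "b \<in> {i, j}" "u \<in> {v, w}" for a b u
  proof -
    have *: "a \<in> {1..2 * CARD('n)}" "b \<in> {1..2 * CARD('n)}" "pair_support u \<subseteq> {1..2 * CARD('n)}"
      using that i(1) j(1) v w by auto
    show ?thesis
      by (simp add: B_def clifford_conj_semispin_pair[OF *(2,3)] clifford_conj_semispin_pair[OF *(1,3)]
          linear_scale[OF linear_clifford_conj] mult.commute)
  qed
  have "pair_sign i v * (B v \<bullet> B w) = clifford_conj i (clifford_conj j (B v)) \<bullet> B w"
    using j by (simp add: T pair_sign_def)
  also have "\<dots> = B v \<bullet> clifford_conj j (clifford_conj i (B w))"
    by (simp add: inner_clifford_conj)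
  also have "\<dots> = pair_sign i w * (B v \<bullet> B w)"
    using j by (simp add: T pair_sign_def)
  finally show ?thesis using i(2) False by simp
qed

lemma semispin_pair_even_ops:
  assumes "pair_support v \<subseteq> {1..2 * CARD('n::{finite,linorder})}"
  shows "semispin_proj s ** pair_op v \<in> (even_ops :: (complex^('n \<Rightarrow> bool)^('n \<Rightarrow> bool)) set)"
proof -
  let ?P = "semispin_proj s :: complex^('n \<Rightarrow> bool)^('n \<Rightarrow> bool)"
  have "?P ** parity_op = parity_op ** ?P"
    by (simp add: vec_eq_iff diagonal_mult_nth parity_op_offdiag semispin_proj_nth)
  then show ?thesis
    using parity_op_pair_op[OF assms]
    unfolding even_ops_def mem_Collect_eq by (metis matrix_mul_assoc)
qed

text \<open>Replacing the right factor by its adjoint makes the scalars cancel, as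
  \<open>\<i> * (- \<i>) = 1\<close>. This brings in the operators from the detection
  condition.\<close>

lemma clifford_conj_twice_pair_op:
  assumes "k \<noteq> l" "k \<in> {1..2 * CARD('n::{finite,linorder})}" "l \<in> {1..2 * CARD('n)}"
  shows "clifford_conj k (clifford_conj l A) =
    pair_op (k, l) ** A ** (pair_op (k, l) :: complex^('n \<Rightarrow> bool)^('n \<Rightarrow> bool))"
proof -
  let ?U = "\<lambda>k. clifford_gen k :: complex^('n \<Rightarrow> bool)^('n \<Rightarrow> bool)"
  have "pair_op (k, l) ** A ** pair_op (k, l) = pair_op (k, l) ** A ** adjoint_mat (pair_op (k, l))"
    using assms adjoint_pair_op[of "(k, l)", where 'n = 'n] by (simp del: pair_op.simps)
  also have "\<dots> = mat \<i> ** (?U k ** ?U l ** A ** ?U l ** ?U k) ** mat (- \<i>)"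
    using assms by (simp add: adjoint_mat_mult adjoint_clifford_gen adjoint_mat_mat matrix_mul_assoc)
  also have "\<dots> = mat \<i> ** mat (- \<i>) ** (?U k ** ?U l ** A ** ?U l ** ?U k)"
    by (metis mat_commute matrix_mul_assoc)
  finally show ?thesis
    by (simp add: mat_mult_mat clifford_conj_def matrix_mul_assoc)
qed

section \<open>The dimension bound\<close>

lemma detecting_code_dim_bound:
  fixes C :: "(complex^('n::{finite,linorder} \<Rightarrow> bool)) set"
  assumes n: "4 \<le> CARD('n)" and C: "vec.subspace C" "C \<subseteq> semispin_space s"
    and det: "\<And>k l. 1 \<le> k \<Longrightarrow> k < l \<Longrightarrow> l \<le> 2 * CARD('n) \<Longrightarrow>
      detects C (semispin_proj s ** clifford_gen k ** clifford_gen l ** semispin_proj s)"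
  defines "m \<equiv> if odd CARD('n) then 4 else (0::real)"
  shows "real (vec.dim C) * (4 * (real CARD('n))\<^sup>2 - m) \<le> (2 * real CARD('n) - m) * 2 ^ (CARD('n) - 1)"
proof (cases "vec.dim C = 0")
  case True
  \<comment> \<open>The zero code is treated apart, since the comparison below divides by the
    dimension.\<close>
  show ?thesis unfolding True using n by (simp add: m_def)
next
  case False
  define d where "d = real (vec.dim C)"
  have d: "d > 0" using False unfolding d_def by linarith
  define K where "K = {1..2 * CARD('n)}"
  define L where "L = {(k, l) \<in> K \<times> K. k < l}"
  define Q where "Q = (semispin_proj s :: complex^('n \<Rightarrow> bool)^('n \<Rightarrow> bool))"
  define P where "P = orth_proj C"
  define S where "S A = (\<Sum>k\<in>K. clifford_conj k A)"
    for A :: "complex^('n \<Rightarrow> bool)^('n \<Rightarrow> bool)"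
  define J where "J v = (pair_op v :: complex^('n \<Rightarrow> bool)^('n \<Rightarrow> bool))" for v
  have P: "is_orth_proj P C"
    unfolding P_def by (rule is_orth_proj_orth_proj[OF C(1)])
  have PP: "P ** P = P" and adjP: "adjoint_mat P = P"
    using P by (auto simp: is_orth_proj_def)
  have trP: "trace P = complex_of_real d"
    using trace_eq_dim[OF P C(1)] by (simp add: d_def)
  have QP: "Q ** P = P"
  proof -
    have "Q *v (P *v v) = P *v v" for v
    proof -
      have "P *v v \<in> range ((*v) Q)"
        using P C(2) semispin_proj_is_orth_proj[of s, where 'a = 'n]
        by (auto simp: is_orth_proj_def Q_def)
      then obtain w where "P *v v = Q *v w" by blast
      then show ?thesis
        by (simp add: matrix_vector_mul_assoc Q_def semispin_proj_mult_self)
    qed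
    then show ?thesis by (simp add: matrix_eq flip: matrix_vector_mul_assoc)
  qed
  have PQ: "P ** Q = P"
    using arg_cong[OF QP, of adjoint_mat]
    by (simp add: adjoint_mat_mult adjP) (simp add: Q_def adjoint_semispin_proj)
  have supp: "pair_support v \<subseteq> {1..2 * CARD('n)}" if "v \<in> insert (0, 0) L" for v
    using that by (auto simp: L_def K_def)
  have fin: "finite K" "finite L"
    by (auto simp: K_def L_def intro: finite_subset[of _ "{1..2 * CARD('n)} \<times> {1..2 * CARD('n)}"])

  \<comment> \<open>\<open>P\<close> absorbs the projections \<open>Q\<close> in a detected
    operator. The scalar is real because \<open>P ** J v ** P\<close> is self-adjoint and
    \<open>P\<close> has nonzero trace.\<close>
  have "\<exists>a. P ** J v ** P = mat (complex_of_real a) ** P" if v: "v \<in> L" for v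
  proof -
    obtain k l where kl: "v = (k, l)" "1 \<le> k" "k < l" "l \<le> 2 * CARD('n)"
      using v by (auto simp: L_def K_def)
    obtain c where "P ** (Q ** clifford_gen k ** clifford_gen l ** Q) ** P = mat c ** P"
      using det[OF kl(2-4)] by (auto simp: detects_def P_def Q_def map_matrix_times)
    then have "(P ** Q) ** clifford_gen k ** clifford_gen l ** (Q ** P) = mat c ** P"
      by (simp only: matrix_mul_assoc)
    then have "mat \<i> ** (P ** clifford_gen k ** clifford_gen l ** P) = mat \<i> ** (mat c ** P)"
      by (simp only: PQ QP)
    then have c: "P ** J v ** P = mat (\<i> * c) ** P"
      using kl by (simp add: J_def mat_commute[of P] matrix_mul_assoc mat_mult_mat)
    have "adjoint_mat (P ** J v ** P) = P ** J v ** P"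
      using adjoint_pair_op[OF supp, of v] v by (simp add: adjoint_mat_mult adjP J_def matrix_mul_assoc)
    then have "mat (cnj (\<i> * c)) ** P = mat (\<i> * c) ** P"
      using arg_cong[OF c, of adjoint_mat] c
      by (simp only: adjoint_mat_mult adjP adjoint_mat_mat mat_commute)
    then have "trace (mat (cnj (\<i> * c)) ** P) = trace (mat (\<i> * c) ** P)" by simp
    then have "cnj (\<i> * c) = \<i> * c"
      using d by (simp only: trace_mat_mult trP mult_cancel_right of_real_eq_0_iff) auto
    then have "\<i> * c = complex_of_real (Re (\<i> * c))"
      by (metis Reals_cnj_iff of_real_Re)
    then show ?thesis using c by metis
  qed
  then obtain a where a: "\<And>v. v \<in> L \<Longrightarrow> P ** J v ** P = mat (complex_of_real (a v)) ** P"
    by metis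
  have trPJ: "trace (P ** J v) = complex_of_real (a v * d)" if "v \<in> L" for v
  proof -
    have "trace (P ** J v) = trace (P ** (P ** J v))"
      by (simp add: matrix_mul_assoc PP)
    also have "\<dots> = trace (P ** J v ** P)" by (rule trace_mul_sym)
    finally show ?thesis by (simp add: a[OF that] trace_mat_mult trP)
  qed

  \<comment> \<open>The components of \<open>P\<close> along the orthogonal family are traces;
    \<open>(0, 0)\<close> stands for the identity.\<close>
  have inner_one: "P \<bullet> (Q ** J (0, 0)) = d"
    by (simp add: J_def inner_matrix Q_def adjoint_semispin_proj)
      (simp add: PQ trP flip: Q_def)
  have inner_pair: "P \<bullet> (Q ** J v) = a v * d" if "v \<in> L" for v
  proof -
    have "adjoint_mat (Q ** J v) = J v ** Q"
      using adjoint_pair_op[OF supp, of v] that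
      by (simp add: adjoint_mat_mult J_def Q_def adjoint_semispin_proj)
    moreover have "trace (P ** (J v ** Q)) = trace (P ** J v)"
    proof -
      have "trace (P ** (J v ** Q)) = trace (P ** J v ** Q)" by (simp only: matrix_mul_assoc)
      also have "\<dots> = trace (Q ** (P ** J v))" by (rule trace_mul_sym)
      finally show ?thesis by (simp only: matrix_mul_assoc QP)
    qed
    ultimately show ?thesis by (simp add: inner_matrix trPJ[OF that])
  qed

  define A where "A = (\<Sum>v\<in>L. (a v)\<^sup>2)"
  \<comment> \<open>The square expands into the inner products \<open>g k l\<close> of
    \<open>P\<close> with \<open>T_k T_l P\<close>: \<open>d\<close> on the diagonal, as
    \<open>T_k\<close> is an involution, and determined by detection off it.\<close>
  have SS: "S P \<bullet> S P = 2 * d * (CARD('n) + A)"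
  proof -
    define g where "g k l = P \<bullet> clifford_conj k (clifford_conj l P)" for k l
    have sym: "g k l = g l k" if "k \<in> K" "l \<in> K" for k l
      using clifford_conj_commute[of k l P] that by (simp add: g_def K_def)
    have diag: "g k k = d" for k
      by (simp add: g_def clifford_conj_involution inner_matrix adjP PP trP)
    have off: "g k l = (a (k, l))\<^sup>2 * d" if kl: "(k, l) \<in> L" for k l
    proof -
      have J: "adjoint_mat (J (k, l)) = J (k, l)"
        unfolding J_def by (rule adjoint_pair_op) (use kl supp in blast)
      have "clifford_conj k (clifford_conj l P) = J (k, l) ** P ** J (k, l)"
        unfolding J_def by (rule clifford_conj_twice_pair_op) (use kl in \<open>auto simp: L_def K_def\<close>)
      then have "g k l = Re (trace (P ** (J (k, l) ** P ** J (k, l))))"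
        by (simp add: g_def inner_matrix adjoint_mat_mult J adjP matrix_mul_assoc)
      \<comment> \<open>Detection enters twice: in replacing \<open>P ** J ** P\<close>, and then in
        the trace of \<open>P ** J\<close>.\<close>
      also have "P ** (J (k, l) ** P ** J (k, l)) = (P ** J (k, l) ** P) ** J (k, l)"
        by (simp only: matrix_mul_assoc)
      also have "\<dots> = mat (complex_of_real (a (k, l))) ** (P ** J (k, l))"
        by (simp only: a[OF kl] matrix_mul_assoc)
      finally show ?thesis
        by (simp add: trace_mat_mult trPJ[OF kl] power2_eq_square)
    qed
    have "(\<Sum>k\<in>K. \<Sum>l\<in>K. g k l) = (\<Sum>k\<in>K. g k k) + 2 * (\<Sum>(k, l)\<in>L. g k l)"
      unfolding L_def by (rule sum_symmetric_pairs) (use fin sym in auto)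
    also have "(\<Sum>(k, l)\<in>L. g k l) = (\<Sum>v\<in>L. (a v)\<^sup>2 * d)"
      by (rule sum.cong) (auto simp: off)
    finally have "(\<Sum>k\<in>K. \<Sum>l\<in>K. g k l) = real (card K) * d + 2 * (\<Sum>v\<in>L. (a v)\<^sup>2 * d)"
      by (simp add: diag)
    moreover have "S P \<bullet> S P = (\<Sum>k\<in>K. \<Sum>l\<in>K. g k l)"
      unfolding S_def inner_sum_clifford_conj
      by (simp add: inner_sum_right linear_sum[OF linear_clifford_conj] g_def)
    ultimately show ?thesis
      by (simp add: A_def K_def sum_distrib_left algebra_simps)
  qed

  \<comment> \<open>The range of \<open>P\<close> has one chirality, so parity acts on
    \<open>P\<close> from the left as a sign; taking adjoints gives the same sign on the
    right.\<close>
  have PW: "P \<in> even_ops"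
  proof -
    have l: "parity_op ** P = (if s = Positive then 1 else -1) *\<^sub>R P"
      by (metis QP Q_def matrix_mul_assoc matrix_mult_scaleR(1) parity_op_semispin_proj)
    then have "adjoint_mat (parity_op ** P) = (if s = Positive then 1 else -1) *\<^sub>R P"
      by (simp add: scaleR_matrix adjoint_mat_mult adjoint_mat_mat adjP mat_commute)
    then have "P ** parity_op = (if s = Positive then 1 else -1) *\<^sub>R P"
      by (simp only: adjoint_mat_mult adjP adjoint_parity_op)
    then show ?thesis by (simp add: even_ops_def l)
  qed

  define lam where "lam v = (2 * real CARD('n) - 2 * real (card (pair_support v)))\<^sup>2" for v
  let ?I = "insert (0, 0) L"
  have "m * (P \<bullet> P - (\<Sum>v\<in>?I. (P \<bullet> (Q ** J v))\<^sup>2) / 2 ^ (CARD('n) - 1)) \<le>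
    S P \<bullet> S P - (\<Sum>v\<in>?I. lam v * (P \<bullet> (Q ** J v))\<^sup>2) / 2 ^ (CARD('n) - 1)"
  proof (rule Bessel_remainder_bound[where W = even_ops])
    show "linear S" unfolding S_def by (rule linear_sum_clifford_conj)
    show "S X \<bullet> Y = X \<bullet> S Y" for X Y unfolding S_def by (rule inner_sum_clifford_conj)
    show "finite ?I" using fin by simp
    show "(Q ** J v) \<bullet> (Q ** J w) = (if v = w then 2 ^ (CARD('n) - 1) else 0)"
      if "v \<in> ?I" "w \<in> ?I" for v w
      unfolding Q_def J_def
    proof (rule inner_semispin_pair[OF n supp[OF that(1)] supp[OF that(2)]])
      \<comment> \<open>The support determines the index: it is empty only for
        \<open>(0, 0)\<close>, and two indices determine the pair with \<open>k < l\<close>.\<close>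
      show "pair_support v \<noteq> pair_support w" if "v \<noteq> w"
        using that \<open>v \<in> ?I\<close> \<open>w \<in> ?I\<close> by (auto simp: L_def doubleton_eq_iff)
    qed
    show "S (S (Q ** J v)) = lam v *\<^sub>R (Q ** J v)" if "v \<in> ?I" for v
      unfolding S_def K_def Q_def J_def lam_def
      by (rule sum_clifford_conj_twice_semispin_pair[OF supp[OF that]])
    show "Q ** J v \<in> even_ops" if "v \<in> ?I" for v
      unfolding Q_def J_def by (rule semispin_pair_even_ops[OF supp[OF that]])
    show "m * (X \<bullet> X) \<le> S X \<bullet> S X" if "X \<in> even_ops" for X
      using sum_clifford_conj_lower_bound[OF that] by (simp add: m_def S_def K_def)
  qed (simp_all add: subspace_even_ops PW)
  moreover have "P \<bullet> P = d"
    by (simp add: inner_matrix adjP PP trP)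
  moreover have "(0, 0) \<notin> L" by (auto simp: L_def)
  then have "(\<Sum>v\<in>?I. (P \<bullet> (Q ** J v))\<^sup>2) = d\<^sup>2 + A * d\<^sup>2"
    using fin by (simp add: inner_one inner_pair power_mult_distrib A_def sum_distrib_right)
  moreover have "(\<Sum>v\<in>?I. lam v * (P \<bullet> (Q ** J v))\<^sup>2) =
      4 * (real CARD('n))\<^sup>2 * d\<^sup>2 + 4 * (real CARD('n) - 2)\<^sup>2 * (A * d\<^sup>2)"
  proof -
    have "lam v = 4 * (real CARD('n) - 2)\<^sup>2" if "v \<in> L" for v
    proof -
      have "card (pair_support v) = 2" using that by (auto simp: L_def)
      then have "lam v = (2 * (real CARD('n) - 2))\<^sup>2" by (simp add: lam_def)
      then show ?thesis unfolding power_mult_distrib by simp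
    qed
    moreover have "lam (0, 0) = 4 * (real CARD('n))\<^sup>2"
      by (simp add: lam_def power_mult_distrib)
    ultimately show ?thesis
      using fin \<open>(0, 0) \<notin> L\<close>
      by (simp add: inner_one inner_pair power_mult_distrib A_def sum_distrib_right sum_distrib_left)
  qed
  ultimately have "m * (d - (d\<^sup>2 + A * d\<^sup>2) / 2 ^ (CARD('n) - 1)) \<le>
      2 * d * (CARD('n) + A) -
      (4 * (real CARD('n))\<^sup>2 * d\<^sup>2 + 4 * (real CARD('n) - 2)\<^sup>2 * (A * d\<^sup>2)) / 2 ^ (CARD('n) - 1)"
    by (simp only: SS)
  \<comment> \<open>An odd \<open>n\<close> that is at least 4 is at least 5, as the case
    \<open>m = 4\<close> of the arithmetic requires.\<close>
  moreover have "m = 0 \<and> real CARD('n) \<ge> 4 \<or> m = 4 \<and> real CARD('n) \<ge> 5"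
  proof (cases "odd CARD('n)")
    case True
    then have "CARD('n) \<noteq> 4" by auto
    then show ?thesis using True n by (simp add: m_def)
  qed (use n in \<open>simp add: m_def\<close>)
  moreover have "A \<ge> 0" by (simp add: A_def sum_nonneg)
  ultimately show ?thesis
    using rank_bound_arithmetic[of d "2 ^ (CARD('n) - 1)" A m "real CARD('n)"] d by (simp add: d_def)
qed

text \<open>Distance 2 yields detection at level \<open>t = 2 - 1\<close> of the metric, which is
  spanned by products of length one.\<close>

lemma semispinorial_code_detects:
  fixes C :: "(complex^('n::{finite,linorder} \<Rightarrow> bool)) set"
  assumes code: "semispinorial_code s C 2" and kl: "1 \<le> k" "k < l" "l \<le> 2 * CARD('n)"
  shows "detects C (semispin_proj s ** clifford_gen k ** clifford_gen l ** semispin_proj s)"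
proof -
  let ?Q = "semispin_proj s :: complex^('n \<Rightarrow> bool)^('n \<Rightarrow> bool)"
  let ?E = "?Q ** clifford_gen k ** clifford_gen l ** ?Q"
  have "\<forall>E \<in> semispinorial_metric s 1. detects C E"
    using code by (auto simp: semispinorial_code_def is_code_distance_def Let_def)
  moreover have "?E \<in> semispin_errors s"
    unfolding semispin_errors_def using kl by (intro cmat.span_base) blast
  \<comment> \<open>The start value of \<open>foldr\<close> appends a projection to
    \<open>E\<close>; it is absorbed because \<open>E\<close> already ends with one.\<close>
  then have "foldr (**) [?E] ?Q \<in> op_products ?Q (semispin_errors s) 1"
    unfolding op_products_def by (intro CollectI exI[of _ "[?E]"]) simp
  then have "?E \<in> op_products ?Q (semispin_errors s) 1"
    by (simp add: semispin_proj_mult_self flip: matrix_mul_assoc)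
  then have "?E \<in> semispinorial_metric s 1"
    by (simp add: semispinorial_metric_def generated_metric_def op_power_def cmat.span_base)
  ultimately show ?thesis by blast
qed

theorem lemma3p5p11:
  fixes C :: "(complex^('n::{finite,linorder} \<Rightarrow> bool)) set" and n :: nat
  assumes n: "n = CARD('n)" "4 \<le> n"
    and code: "semispinorial_code Positive C 2 \<or> semispinorial_code Negative C 2"
  shows "(even n \<longrightarrow> real (vec.dim C) \<le> 1 / real n * 2 ^ (n - 2)) \<and>
         (odd n \<longrightarrow> real (vec.dim C) \<le> (real n - 2) / ((real n)^2 - 1) * 2 ^ (n - 2))"
proof -
  obtain s where s: "semispinorial_code s C 2" using code by blast
  have pow: "(2::real) ^ (n - 1) = 2 * 2 ^ (n - 2)"
    using n(2) by (simp flip: power_Suc add: Suc_diff_Suc numeral_2_eq_2)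
  have bound: "real (vec.dim C) * (4 * (real n)\<^sup>2 - (if odd n then 4 else 0)) \<le>
      (2 * real n - (if odd n then 4 else 0)) * 2 ^ (n - 1)"
    unfolding n(1)
    by (rule detecting_code_dim_bound[where s = s])
      (use n s semispinorial_code_detects[OF s] in \<open>auto simp: semispinorial_code_def\<close>)
  have sq: "(real n)\<^sup>2 > 1" using n(2) by simp
  show ?thesis
  proof (intro conjI impI)
    assume "even n"
    \<comment> \<open>This is the bound divided by 4; the common factor \<open>n\<close> is
      cancelled next.\<close>
    then have "real n * (real (vec.dim C) * real n) \<le> real n * 2 ^ (n - 2)"
      using bound unfolding pow by (simp add: power2_eq_square algebra_simps)
    then have "real (vec.dim C) * real n \<le> 2 ^ (n - 2)"
      by (rule mult_left_le_imp_le) (use n(2) in simp)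
    then show "real (vec.dim C) \<le> 1 / real n * 2 ^ (n - 2)"
      using n(2) by (simp add: pos_le_divide_eq)
  next
    assume "odd n"
    then have "real (vec.dim C) * ((real n)\<^sup>2 - 1) \<le> (real n - 2) * 2 ^ (n - 2)"
      using bound unfolding pow by (simp add: algebra_simps)
    then show "real (vec.dim C) \<le> (real n - 2) / ((real n)^2 - 1) * 2 ^ (n - 2)"
      using sq by (simp add: pos_le_divide_eq)
  qed
qed

end
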